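(* Assume one of the polynomials $h_i$ defining $\mathcal{D}$ equals $R_{\mathcal{D}}-\|\bm{d}\|^2$ for some constant $R_{\mathcal{D}}\ge 0$. Let $N$ be a positive integer and let $\{\psi_{k+N}\}_{k=1}^{\infty}$ be a sequence of polynomials such that, for each $k$, $\psi_{k+N}\in\mathbb{R}_{k+N}[\bm{x},t]$ satisfies the sum-of-squares constraints (SOS) given in the context, and such that $\psi_{k+N}\to u$ uniformly on $B(\bm{0},R)\times[0,T]$ as $k\to\infty$. Put $\mathcal{X}_{0k}=\{\bm{x}\in\mathcal{X}_0\mid \psi_{k+N}(\bm{x},0)\le 0\}$. Then $\mathcal{X}_{0k}\subset\mathcal{R}_0$ for all $k$, and \[\lim_{k\to\infty}\mu(\mathcal{R}_0\setminus\mathcal{X}_{0k})=\mu(\partial\mathcal{R}_0),\] where $\partial\mathcal{R}_0=\{\bm{x}\in\mathbb{R}^n\mid u(\bm{x},0)=0\}$ and $\mu$ is the Lebesgue measure on $\mathbb{R}^n$.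
   Context: Setting. $n,m$ are positive integers, $T>0$, $\|\cdot\|$ is the Euclidean norm. $\bm{f}:\mathbb{R}^n\times\mathbb{R}^m\to\mathbb{R}^n$ has polynomial components $f_i\in\mathbb{R}[\bm{x},\bm{d}]$. $\mathcal{D}=\{\bm{d}\in\mathbb{R}^m\mid h_i(\bm{d})\ge0,\ i=1,\dots,n_{\mathcal{D}}\}$ is a (nonempty) compact set with $h_i\in\mathbb{R}[\bm{d}]$. For $t\in[0,T]$, $\mathcal{X}_t=\{\bm{x}\in\mathbb{R}^n\mid g_i(\bm{x},t)\le0,\ i=1,\dots,n_{\mathcal{X}}\}$ is compact, with $g_i\in\mathbb{R}[\bm{x},t]$ and $\partial\mathcal{X}_t=\bigcup_{i}\{\bm{x}\in\mathcal{X}_t\mid g_i(\bm{x},t)=0\}$. The target is $\mathtt{TR}=\{\bm{x}\in\mathbb{R}^n\mid l_i(\bm{x})\le0,\ i=1,\dots,n_{\mathtt{TR}}\}$ with $l_i\in\mathbb{R}[\bm{x}]$ and $\partial\mathtt{TR}=\bigcup_i\{\bm{x}\in\mathtt{TR}\mid l_i(\bm{x})=0\}$. $R>0$ is a number and $B(\bm{0},R)=\{\bm{x}\in\mathbb{R}^n\mid g_R(\bm{x})\ge0\}$ with $g_R(\bm{x})=R-\sum_{i=1}^n x_i^2$, chosen so that for all $t\in[0,T]$: $\mathcal{X}_t\subseteq B(\bm{0},R)$ and $\partial\mathcal{X}_t\cap\partial B(\bm{0},R)=\emptyset$. $\bm{F}:\mathbb{R}^n\times\mathcal{D}\to\mathbb{R}^n$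 is a continuous map, globally Lipschitz in $\bm{x}\in\mathbb{R}^n$ uniformly in $\bm{d}\in\mathcal{D}$, with $\bm{F}=\bm{f}$ on $B(\bm{0},R)\times\mathcal{D}$. $\mathcal{M}_t$ is the set of measurable functions $\bm{d}:[t,T]\to\mathcal{D}$. For $\bm{d}\in\mathcal{M}_t$, $\bm{y}_{\bm{x},t}^{\bm{d}}$ is the (absolutely continuous) solution of $\dot{\bm{x}}(s)=\bm{f}(\bm{x}(s),\bm{d}(s))$ a.e. with value $\bm{x}$ at time $t$, and $\bm{\phi}_{\bm{x},t}^{\bm{d}}:[t,T]\to\mathbb{R}^n$ is the solution of $\dot{\bm{x}}(s)=\bm{F}(\bm{x}(s),\bm{d}(s))$ a.e. with value $\bm{x}$ at time $t$. Backward reachable set: $\mathcal{R}_0=\{\bm{x}_0\in\mathbb{R}^n\mid \forall\bm{d}\in\mathcal{M}_0:\ \bm{y}_{\bm{x}_0,0}^{\bm{d}}(s)\in\mathcal{X}_s\ \forall s\in[0,T]\text{ and }\bm{y}_{\bm{x}_0,0}^{\bm{d}}(T)\in\mathtt{TR}\}$ (in particular the solution is required to exist on $[0,T]$). Value function: for $(\bm{x},t)\in\mathbb{R}^n\times[0,T]$, \[u(\bm{x},t)=\sup_{\bm{d}\in\mathcal{M}_t}\max\Big\{\max_{i}l_i(\bm{\phi}_{\bm{x},t}^{\bm{d}}(T)),\ \max_{i}\max_{s\in[t,T]}g_i(\bm{\phi}_{\bm{x},t}^{\bm{d}}(s),s)\Big\}.\] $\mathbb{R}_k[\cdot]$ denotes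 the real polynomials of total degree $\le k$ in the listed variables. A polynomial $\psi\in\mathbb{R}[\bm{x},t]$ satisfies (SOS) if there exist sum-of-squares polynomials $s_0,s_1,s_2,s'_r$ ($r=1,\dots,n_{\mathcal{D}}$) in $(\bm{x},t,\bm{d})$, $s_{3,i},s_{4,i},s_{5,i}$ ($i=1,\dots,n_{\mathcal{X}}$) in $(\bm{x},t)$, and $s_{6,j},s_{7,j}$ ($j=1,\dots,n_{\mathtt{TR}}$) in $\bm{x}$ (of any degrees) such that, as polynomial identities, \[-\big(\partial_t\psi(\bm{x},t)+\nabla_{\bm{x}}\psi(\bm{x},t)\cdot\bm{f}(\bm{x},\bm{d})\big)=s_0+s_1g_R(\bm{x})+s_2\,t(T-t)+\sum_{r=1}^{n_{\mathcal{D}}}s'_r h_r(\bm{d}),\] \[\psi(\bm{x},t)-g_i(\bm{x},t)=s_{3,i}+s_{4,i}g_R(\bm{x})+s_{5,i}\,t(T-t),\quad i=1,\dots,n_{\mathcal{X}},\] \[\psi(\bm{x},T)-l_j(\bm{x})=s_{6,j}+s_{7,j}g_R(\bm{x}),\quad j=1,\dots,n_{\mathtt{TR}}.\] *)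

theory Defs
  imports "HOL-Analysis.Analysis" "HOL-Library.Poly_Mapping"
begin

text \<open>
  All polynomials live in the single ring $R[x,t,d]$, whose variables are the
  components of the state, the time and the components of the disturbance.  The ring
  structure is the one of the monoid algebra provided by the theory of finitely supported
  maps.  The subrings $R[x]$, $R[d]$, $R[x,t]$, $R[x,d]$ are cut out by restricting the
  variables which occur.
\<close>

datatype ('n, 'm) var = State 'n | Time | Dist 'm

type_synonym ('n, 'm) rpoly = "(('n, 'm) var \<Rightarrow>\<^sub>0 nat) \<Rightarrow>\<^sub>0 real"

definition Const :: "real \<Rightarrow> ('n, 'm) rpoly" where
  "Const c = Poly_Mapping.single 0 c"

definition Var :: "('n, 'm) var \<Rightarrow> ('n, 'm) rpoly" where
  "Var v = Poly_Mapping.single (Poly_Mapping.single v 1) 1"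

definition polys_in :: "('n, 'm) var set \<Rightarrow> ('n, 'm) rpoly set" where
  "polys_in V = {p. \<forall>m \<in> Poly_Mapping.keys p. Poly_Mapping.keys m \<subseteq> V}"

definition polys_deg_le :: "('n, 'm) var set \<Rightarrow> nat \<Rightarrow> ('n, 'm) rpoly set" where
  "polys_deg_le V k = {p \<in> polys_in V. \<forall>m \<in> Poly_Mapping.keys p.
     (\<Sum>v \<in> Poly_Mapping.keys m. Poly_Mapping.lookup m v) \<le> k}"

abbreviation x_vars :: "('n, 'm) var set" where "x_vars \<equiv> State ` UNIV"
abbreviation d_vars :: "('n, 'm) var set" where "d_vars \<equiv> Dist ` UNIV"
abbreviation xt_vars :: "('n, 'm) var set" where "xt_vars \<equiv> x_vars \<union> {Time}"
abbreviation xd_vars :: "('n, 'm) var set" where "xd_vars \<equiv> x_vars \<union> d_vars"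
abbreviation xtd_vars :: "('n, 'm) var set" where "xtd_vars \<equiv> x_vars \<union> {Time} \<union> d_vars"

text \<open>
  The homomorphism into a commutative algebra given by a coefficient map and an assignment
  of the variables.  It serves both for evaluation (into the reals) and for substitution
  (into the polynomial ring).
\<close>

definition poly_hom :: "(real \<Rightarrow> 'a) \<Rightarrow> (('n, 'm) var \<Rightarrow> 'a) \<Rightarrow> ('n, 'm) rpoly \<Rightarrow> 'a::comm_semiring_1" where
  "poly_hom c \<rho> p = (\<Sum>m \<in> Poly_Mapping.keys p.
     c (Poly_Mapping.lookup p m) *
     (\<Prod>v \<in> Poly_Mapping.keys m. \<rho> v ^ Poly_Mapping.lookup m v))"

fun assignment :: "real ^ 'n \<Rightarrow> real \<Rightarrow> real ^ 'm \<Rightarrow> ('n, 'm) var \<Rightarrow> real" where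
  "assignment x t d (State i) = x $ i"
| "assignment x t d Time = t"
| "assignment x t d (Dist j) = d $ j"

definition eval_xtd :: "('n::finite, 'm::finite) rpoly \<Rightarrow> real ^ 'n \<Rightarrow> real \<Rightarrow> real ^ 'm \<Rightarrow> real" where
  "eval_xtd p x t d = poly_hom (\<lambda>c. c) (assignment x t d) p"

text \<open>The value \<open>0\<close> is a dummy for variables which do not occur in the polynomial.\<close>

abbreviation eval_x :: "('n::finite, 'm::finite) rpoly \<Rightarrow> real ^ 'n \<Rightarrow> real" where
  "eval_x p x \<equiv> eval_xtd p x 0 0"

abbreviation eval_d :: "('n::finite, 'm::finite) rpoly \<Rightarrow> real ^ 'm \<Rightarrow> real" where
  "eval_d p d \<equiv> eval_xtd p 0 0 d"

abbreviation eval_xt :: "('n::finite, 'm::finite) rpoly \<Rightarrow> real ^ 'n \<Rightarrow> real \<Rightarrow> real" where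
  "eval_xt p x t \<equiv> eval_xtd p x t 0"

abbreviation eval_xd :: "('n::finite, 'm::finite) rpoly \<Rightarrow> real ^ 'n \<Rightarrow> real ^ 'm \<Rightarrow> real" where
  "eval_xd p x d \<equiv> eval_xtd p x 0 d"

definition subst_time :: "real \<Rightarrow> ('n, 'm) rpoly \<Rightarrow> ('n, 'm) rpoly" where
  "subst_time T p = poly_hom Const (Var(Time := Const T)) p"

text \<open>
  Formal partial derivative.  The subtraction of exponents is truncated, which is harmless
  because the coefficient vanishes whenever \<open>v\<close> does not occur in the monomial.
\<close>

definition partial :: "('n, 'm) var \<Rightarrow> ('n, 'm) rpoly \<Rightarrow> ('n, 'm) rpoly" where
  "partial v p = (\<Sum>m \<in> Poly_Mapping.keys p.
     Poly_Mapping.single (m - Poly_Mapping.single v 1)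
       (Poly_Mapping.lookup p m * real (Poly_Mapping.lookup m v)))"

definition sos_in :: "('n, 'm) var set \<Rightarrow> ('n, 'm) rpoly set" where
  "sos_in V = {p. \<exists>(r::nat) q. (\<forall>i<r. q i \<in> polys_in V) \<and> p = (\<Sum>i<r. q i ^ 2)}"

definition gR :: "real \<Rightarrow> ('n::finite, 'm::finite) rpoly" where
  "gR R = Const R - (\<Sum>i\<in>UNIV. Var (State i) ^ 2)"

text \<open>
  The ball below is described by the inequality \<open>R - \<parallel>x\<parallel>\<^sup>2 \<ge> 0\<close>, so that its radius is the
  square root of \<open>R\<close>.
\<close>

definition ballR :: "real \<Rightarrow> (real ^ 'n::finite) set" where
  "ballR R = {x. R - (\<Sum>i\<in>UNIV. (x $ i)\<^sup>2) \<ge> 0}"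

definition dist_set :: "nat \<Rightarrow> (nat \<Rightarrow> ('n::finite, 'm::finite) rpoly) \<Rightarrow> (real ^ 'm) set" where
  "dist_set nD h = {d. \<forall>i\<in>{1..nD}. eval_d (h i) d \<ge> 0}"

definition state_set :: "nat \<Rightarrow> (nat \<Rightarrow> ('n::finite, 'm::finite) rpoly) \<Rightarrow> real \<Rightarrow> (real ^ 'n) set" where
  "state_set nX g t = {x. \<forall>i\<in>{1..nX}. eval_xt (g i) x t \<le> 0}"

definition state_set_boundary :: "nat \<Rightarrow> (nat \<Rightarrow> ('n::finite, 'm::finite) rpoly) \<Rightarrow> real \<Rightarrow> (real ^ 'n) set" where
  "state_set_boundary nX g t = (\<Union>i\<in>{1..nX}. {x \<in> state_set nX g t. eval_xt (g i) x t = 0})"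

definition target_set :: "nat \<Rightarrow> (nat \<Rightarrow> ('n::finite, 'm::finite) rpoly) \<Rightarrow> (real ^ 'n) set" where
  "target_set nTR l = {x. \<forall>j\<in>{1..nTR}. eval_x (l j) x \<le> 0}"

definition vector_field :: "('n \<Rightarrow> ('n::finite, 'm::finite) rpoly) \<Rightarrow> real ^ 'n \<Rightarrow> real ^ 'm \<Rightarrow> real ^ 'n" where
  "vector_field f x d = (\<chi> i. eval_xd (f i) x d)"

definition abs_continuous :: "real \<Rightarrow> real \<Rightarrow> (real \<Rightarrow> 'a::real_normed_vector) \<Rightarrow> bool" where
  "abs_continuous a b y \<longleftrightarrow>
     (\<forall>\<epsilon>>0. \<exists>\<delta>>0. \<forall>(r::nat) p q.
        (\<forall>i<r. a \<le> p i \<and> p i \<le> q i \<and> q i \<le> b) \<and>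
        disjoint_family_on (\<lambda>i. {p i<..<q i}) {..<r} \<and>
        (\<Sum>i<r. q i - p i) < \<delta> \<longrightarrow>
        (\<Sum>i<r. norm (y (q i) - y (p i))) < \<epsilon>)"

definition inputs :: "(real ^ 'm::finite) set \<Rightarrow> real \<Rightarrow> real \<Rightarrow> (real \<Rightarrow> real ^ 'm) set" where
  "inputs D T t = {d. d \<in> borel_measurable (lebesgue_on {t..T}) \<and> (\<forall>s\<in>{t..T}. d s \<in> D)}"

text \<open>
  \<open>y\<close> is a Caratheodory solution on \<open>{t..T}\<close> of \<open>y' = G (y, d)\<close> with value \<open>x\<close> at time \<open>t\<close>.
  Only the restriction of \<open>y\<close> to \<open>{t..T}\<close> is relevant.
\<close>

definition solution ::
  "(real ^ 'n::finite \<Rightarrow> real ^ 'm::finite \<Rightarrow> real ^ 'n) \<Rightarrow> real \<Rightarrow> real ^ 'n \<Rightarrow> real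
    \<Rightarrow> (real \<Rightarrow> real ^ 'm) \<Rightarrow> (real \<Rightarrow> real ^ 'n) \<Rightarrow> bool" where
  "solution G T x t d y \<longleftrightarrow>
     abs_continuous t T y \<and> y t = x \<and>
     (AE s in lebesgue_on {t..T}. (y has_vector_derivative G (y s) (d s)) (at s within {t..T}))"

text \<open>
  Solutions are unique on \<open>{0..T}\<close>, as polynomial vector fields are locally Lipschitz in the
  state, uniformly over the compact set of disturbances.  Hence the existential quantifier says
  that the solution exists on the whole interval and satisfies the constraints.
\<close>

definition reach_set ::
  "(real ^ 'n::finite \<Rightarrow> real ^ 'm::finite \<Rightarrow> real ^ 'n) \<Rightarrow> (real ^ 'm) set \<Rightarrow> real
    \<Rightarrow> (real \<Rightarrow> (real ^ 'n) set) \<Rightarrow> (real ^ 'n) set \<Rightarrow> (real ^ 'n) set" where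
  "reach_set G D T X TR =
     {x\<^sub>0. \<forall>d \<in> inputs D T 0. \<exists>y. solution G T x\<^sub>0 0 d y \<and>
           (\<forall>s\<in>{0..T}. y s \<in> X s) \<and> y T \<in> TR}"

text \<open>
  The inner supremum over \<open>s\<close> is a maximum since \<open>\<phi>\<close> is continuous on \<open>{t..T}\<close>.
\<close>

definition cost ::
  "nat \<Rightarrow> (nat \<Rightarrow> ('n::finite, 'm::finite) rpoly) \<Rightarrow> nat \<Rightarrow> (nat \<Rightarrow> ('n, 'm) rpoly) \<Rightarrow> real
    \<Rightarrow> real \<Rightarrow> (real \<Rightarrow> real ^ 'n) \<Rightarrow> real" where
  "cost nX g nTR l T t \<phi> =
     max (MAX j\<in>{1..nTR}. eval_x (l j) (\<phi> T))
         (MAX i\<in>{1..nX}. SUP s\<in>{t..T}. eval_xt (g i) (\<phi> s) s)"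

text \<open>
  For each input the solution of \<open>\<phi>' = F (\<phi>, d)\<close> exists and is unique on \<open>{t..T}\<close>, so
  that the supremum over the pairs \<open>(d, \<phi>)\<close> is the supremum over the inputs \<open>d\<close>.
\<close>

definition value_fun ::
  "(real ^ 'n::finite \<Rightarrow> real ^ 'm::finite \<Rightarrow> real ^ 'n) \<Rightarrow> (real ^ 'm) set
    \<Rightarrow> nat \<Rightarrow> (nat \<Rightarrow> ('n, 'm) rpoly) \<Rightarrow> nat \<Rightarrow> (nat \<Rightarrow> ('n, 'm) rpoly) \<Rightarrow> real
    \<Rightarrow> real ^ 'n \<Rightarrow> real \<Rightarrow> real" where
  "value_fun F D nX g nTR l T x t =
     Sup {cost nX g nTR l T t \<phi> | d \<phi>. d \<in> inputs D T t \<and> solution F T x t d \<phi>}"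

definition sos_constraints ::
  "real \<Rightarrow> real \<Rightarrow> ('n::finite \<Rightarrow> ('n, 'm::finite) rpoly) \<Rightarrow> nat \<Rightarrow> (nat \<Rightarrow> ('n, 'm) rpoly)
    \<Rightarrow> nat \<Rightarrow> (nat \<Rightarrow> ('n, 'm) rpoly) \<Rightarrow> nat \<Rightarrow> (nat \<Rightarrow> ('n, 'm) rpoly)
    \<Rightarrow> ('n, 'm) rpoly \<Rightarrow> bool" where
  "sos_constraints T R f nD h nX g nTR l \<psi> \<longleftrightarrow>
     (\<exists>s\<^sub>0 \<in> sos_in xtd_vars. \<exists>s\<^sub>1 \<in> sos_in xtd_vars. \<exists>s\<^sub>2 \<in> sos_in xtd_vars.
      \<exists>s' \<in> {1..nD} \<rightarrow> sos_in xtd_vars.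
        - (partial Time \<psi> + (\<Sum>i\<in>UNIV. partial (State i) \<psi> * f i)) =
        s\<^sub>0 + s\<^sub>1 * gR R + s\<^sub>2 * (Var Time * (Const T - Var Time)) + (\<Sum>r\<in>{1..nD}. s' r * h r)) \<and>
     (\<forall>i\<in>{1..nX}. \<exists>s\<^sub>3 \<in> sos_in xt_vars. \<exists>s\<^sub>4 \<in> sos_in xt_vars. \<exists>s\<^sub>5 \<in> sos_in xt_vars.
        \<psi> - g i = s\<^sub>3 + s\<^sub>4 * gR R + s\<^sub>5 * (Var Time * (Const T - Var Time))) \<and>
     (\<forall>j\<in>{1..nTR}. \<exists>s\<^sub>6 \<in> sos_in x_vars. \<exists>s\<^sub>7 \<in> sos_in x_vars.
        subst_time T \<psi> - l j = s\<^sub>6 + s\<^sub>7 * gR R)"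

end

theory Submission
  imports Defs
begin

text \<open>
  A trajectory that starts at \<open>x\<close> with \<open>\<psi>(x, 0) \<le> 0\<close> satisfies \<open>\<psi> \<le> 0\<close> as long as it stays in the
  ball, because the first constraint makes \<open>\<psi>\<close> nonincreasing along it; the second one then puts the
  state into \<open>X\<^sub>s\<close>, which lies in the interior of the ball, so that the trajectory never leaves the
  ball and solves both differential equations. Hence the sublevel sets are contained in the
  reachable set, which equals \<open>{u \<le> 0}\<close>. The indicator functions of the differences converge to the
  one of \<open>{u = 0}\<close> outside the zero sets of the polynomials \<open>\<psi>\<^sub>k(\<cdot>, 0)\<close>. These are null sets for large
  \<open>k\<close>: at a point of the bounding sphere \<open>u > 0\<close>, so \<open>\<psi>\<^sub>k(\<cdot>, 0)\<close> is not identically zero.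
\<close>

section \<open>Polynomials\<close>

text \<open>Inputs are merely measurable, so the differential equations hold only almost everywhere;
  absolute continuity is what carries inequalities between derivatives off a null set over to
  increments. Solutions for \<open>vector_field f\<close> may fail to exist on the whole interval.
  Every argument is therefore run with solutions for \<open>F\<close>, which exist for each input,
  are unique, and are bounded uniformly in the input. This bound matters since
  \<open>value_fun\<close> is a supremum of reals, which is informative only for nonempty sets that
  are bounded above.

  No regularity of \<open>u\<close> is derived from the dynamics: as a uniform limit of polynomials,
  \<open>u\<close> at time 0 is continuous on the ball, and this gives the measurability of the
  reachable set and of \<open>{u = 0}\<close>. That sublevel sets miss almost every point of
  \<open>{u = 0}\<close> rests on the inequality between \<open>u\<close> and \<psi> at time 0 on
  the reachable set: trajectories from there stay in the ball, so \<psi> at the starting point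
  bounds every cost.\<close>

lemma UNIV_var: "(UNIV :: ('n, 'm) var set) = range State \<union> ({Time} \<union> range Dist)"
proof -
  have "v \<in> range State \<union> ({Time} \<union> range Dist)" for v :: "('n, 'm) var"
    by (cases v) auto
  then show ?thesis by auto
qed

lemma finite_var [simp]: "finite (A :: ('n::finite, 'm::finite) var set)"
proof -
  have "finite (range State \<union> ({Time} \<union> range Dist) :: ('n, 'm) var set)"
    by simp
  then have "finite (UNIV :: ('n, 'm) var set)"
    by (simp only: UNIV_var)
  then show ?thesis
    by (rule finite_subset [OF subset_UNIV])
qed

lemma sum_UNIV_var:
  "(\<Sum>v\<in>UNIV. F v) = (\<Sum>i\<in>UNIV. F (State i)) + F Time + (\<Sum>j\<in>UNIV. F (Dist j))"
  for F :: "('n::finite, 'm::finite) var \<Rightarrow> 'a::comm_monoid_add"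
proof -
  have "(\<Sum>v\<in>UNIV. F v) = (\<Sum>v\<in>range State. F v) + (\<Sum>v\<in>{Time} \<union> range Dist. F v)"
    by (subst UNIV_var, rule sum.union_disjoint) auto
  also have "(\<Sum>v\<in>{Time} \<union> range Dist. F v) = F Time + (\<Sum>v\<in>range Dist. F v)"
    by (subst sum.union_disjoint) auto
  finally show ?thesis
    by (simp add: sum.reindex inj_on_def add.assoc)
qed

section \<open>Evaluation of polynomials as a ring homomorphism\<close>

abbreviation ev :: "(('n::finite, 'm::finite) var \<Rightarrow> real) \<Rightarrow> ('n, 'm) rpoly \<Rightarrow> real" where
  "ev \<rho> \<equiv> poly_hom (\<lambda>c. c) \<rho>"

text \<open>The product runs over all variables, not only those in \<open>keys m\<close>; with the
  index set independent of \<open>m\<close>, multiplicativity in \<open>m\<close> reduces to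
  \<open>power_add\<close>.\<close>

abbreviation monom_eval :: "(('n::finite, 'm::finite) var \<Rightarrow> real) \<Rightarrow> (('n, 'm) var \<Rightarrow>\<^sub>0 nat) \<Rightarrow> real" where
  "monom_eval \<rho> m \<equiv> (\<Prod>v\<in>UNIV. \<rho> v ^ Poly_Mapping.lookup m v)"

lemma monom_eval_keys: "(\<Prod>v\<in>Poly_Mapping.keys m. \<rho> v ^ Poly_Mapping.lookup m v) = monom_eval \<rho> m"
  by (rule prod.mono_neutral_left) (auto simp: in_keys_iff)

lemma ev_eq: "ev \<rho> p = (\<Sum>m\<in>Poly_Mapping.keys p. Poly_Mapping.lookup p m * monom_eval \<rho> m)"
  unfolding poly_hom_def by (simp add: monom_eval_keys)

lemma ev_superset:
  assumes "finite S" "Poly_Mapping.keys p \<subseteq> S"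
  shows "ev \<rho> p = (\<Sum>m\<in>S. Poly_Mapping.lookup p m * monom_eval \<rho> m)"
  unfolding ev_eq by (rule sum.mono_neutral_left) (use assms in \<open>auto simp: in_keys_iff\<close>)

lemma ev_zero [simp]: "ev \<rho> 0 = 0"
  by (simp add: poly_hom_def)

lemma ev_single [simp]: "ev \<rho> (Poly_Mapping.single m a) = a * monom_eval \<rho> m"
  by (subst ev_superset[of "{m}"]) auto

lemma ev_add [simp]: "ev \<rho> (p + q) = ev \<rho> p + ev \<rho> q"
proof -
  let ?S = "Poly_Mapping.keys p \<union> Poly_Mapping.keys q"
  have "ev \<rho> (p + q) = (\<Sum>m\<in>?S. Poly_Mapping.lookup (p + q) m * monom_eval \<rho> m)"
    by (rule ev_superset) (auto simp: keys_add)
  moreover have "ev \<rho> p = (\<Sum>m\<in>?S. Poly_Mapping.lookup p m * monom_eval \<rho> m)"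
    by (rule ev_superset) auto
  moreover have "ev \<rho> q = (\<Sum>m\<in>?S. Poly_Mapping.lookup q m * monom_eval \<rho> m)"
    by (rule ev_superset) auto
  ultimately show ?thesis
    by (simp add: lookup_add distrib_right sum.distrib)
qed

lemma ev_uminus [simp]: "ev \<rho> (- p) = - ev \<rho> p"
  using ev_add[of \<rho> p "- p"] by (simp del: ev_add)

lemma ev_diff [simp]: "ev \<rho> (p - q) = ev \<rho> p - ev \<rho> q"
  using ev_add[of \<rho> p "- q"] by (simp del: ev_add)

lemma ev_sum [simp]: "ev \<rho> (\<Sum>i\<in>A. P i) = (\<Sum>i\<in>A. ev \<rho> (P i))"
  by (induction A rule: infinite_finite_induct) auto

lemma rpoly_sum_monomials: "p = (\<Sum>m\<in>Poly_Mapping.keys p. Poly_Mapping.single m (Poly_Mapping.lookup p m))"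
  by (rule poly_mapping_eqI) (auto simp: lookup_sum lookup_single when_def in_keys_iff)

lemma monom_eval_add: "monom_eval \<rho> (m + m') = monom_eval \<rho> m * monom_eval \<rho> m'"
  by (simp add: lookup_add power_add prod.distrib)

lemma ev_mult [simp]: "ev \<rho> (p * q) = ev \<rho> p * ev \<rho> q"
proof -
  have "p * q = (\<Sum>m\<in>Poly_Mapping.keys p. \<Sum>m'\<in>Poly_Mapping.keys q.
      Poly_Mapping.single (m + m') (Poly_Mapping.lookup p m * Poly_Mapping.lookup q m'))"
    by (subst rpoly_sum_monomials[of p], subst rpoly_sum_monomials[of q])
       (simp add: sum_product mult_single)
  then have "ev \<rho> (p * q) = (\<Sum>m\<in>Poly_Mapping.keys p. \<Sum>m'\<in>Poly_Mapping.keys q.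
      (Poly_Mapping.lookup p m * Poly_Mapping.lookup q m') * (monom_eval \<rho> m * monom_eval \<rho> m'))"
    by (simp only: ev_sum ev_single monom_eval_add)
  then show ?thesis
    by (simp add: ev_eq sum_product mult_ac)
qed

lemma ev_Const [simp]: "ev \<rho> (Const c) = c"
  by (simp add: Const_def)

lemma ev_one [simp]: "ev \<rho> 1 = 1"
  by (metis ev_Const Const_def single_one)

lemma ev_Var [simp]: "ev \<rho> (Var v) = \<rho> v"
proof -
  have "ev \<rho> (Var v) = (\<Prod>w\<in>UNIV. if w = v then \<rho> w else 1)"
    unfolding Var_def ev_single mult_1_left
    by (rule prod.cong) (auto simp: lookup_single when_def)
  then show ?thesis by simp
qed

lemma ev_power [simp]: "ev \<rho> (p ^ k) = ev \<rho> p ^ k"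
  by (induction k) auto

lemma ev_prod [simp]: "ev \<rho> (\<Prod>i\<in>A. P i) = (\<Prod>i\<in>A. ev \<rho> (P i))"
  by (induction A rule: infinite_finite_induct) auto

lemma ev_cong_polys_in:
  assumes "p \<in> polys_in V" "\<And>v. v \<in> V \<Longrightarrow> \<rho> v = \<sigma> v"
  shows "ev \<rho> p = ev \<sigma> p"
  unfolding poly_hom_def
proof (intro sum.cong refl arg_cong2[where f="(*)"] prod.cong)
  fix m v assume "m \<in> Poly_Mapping.keys p" "v \<in> Poly_Mapping.keys m"
  then have "v \<in> V"
    using assms(1) unfolding polys_in_def by blast
  then show "\<rho> v ^ Poly_Mapping.lookup m v = \<sigma> v ^ Poly_Mapping.lookup m v"
    using assms(2) by simp
qed

lemma ev_sos_nonneg: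
  assumes "p \<in> sos_in V"
  shows "ev \<rho> p \<ge> 0"
  using assms by (auto simp: sos_in_def intro!: sum_nonneg)

lemma ev_subst_time: "ev \<rho> (subst_time T p) = ev (\<rho>(Time := T)) p"
proof -
  have "ev \<rho> ((Var(Time := Const T)) v) = (\<rho>(Time := T)) v" for v
    by simp
  then show ?thesis
    unfolding subst_time_def
    \<comment> \<open>Only the homomorphism with coefficient map \<open>Const\<close> is unfolded,
      so that \<open>ev\<close> can be pushed through the resulting sum of products.\<close>
    by (simp only: poly_hom_def[of Const] ev_sum ev_mult ev_prod ev_power ev_Const)
       (simp add: poly_hom_def)
qed

lemma continuous_on_ev:
  assumes "\<And>v. continuous_on S (\<lambda>z. \<rho> z v)"
  shows "continuous_on S (\<lambda>z. ev (\<rho> z) p)"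
  unfolding ev_eq by (intro continuous_intros assms)

section \<open>Derivatives of polynomials along curves\<close>

lemma has_field_derivative_prod_within:
  fixes F :: "'i \<Rightarrow> 'a::real_normed_field \<Rightarrow> 'a"
  assumes "\<And>i. i \<in> I \<Longrightarrow> (F i has_field_derivative F' i) (at x within S)"
  shows "((\<lambda>x. \<Prod>i\<in>I. F i x) has_field_derivative (\<Sum>i\<in>I. F' i * (\<Prod>j\<in>I - {i}. F j x))) (at x within S)"
proof -
  have "((\<lambda>x. \<Prod>i\<in>I. F i x) has_derivative (\<lambda>y. \<Sum>i\<in>I. (F' i * y) * (\<Prod>j\<in>I - {i}. F j x))) (at x within S)"
    by (rule has_derivative_prod) (use assms in \<open>simp add: has_field_derivative_def\<close>)
  then show ?thesis
    unfolding has_field_derivative_def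
    by (rule has_derivative_eq_rhs) (simp add: fun_eq_iff sum_distrib_left mult_ac)
qed

lemma has_real_derivative_monom_eval:
  assumes "\<And>v. ((\<lambda>s. \<rho> s v) has_real_derivative \<rho>' v) (at s within S)"
  shows "((\<lambda>s. monom_eval (\<rho> s) m) has_real_derivative
    (\<Sum>v\<in>UNIV. \<rho>' v * (real (Poly_Mapping.lookup m v) * monom_eval (\<rho> s) (m - Poly_Mapping.single v 1))))
    (at s within S)"
proof -
  let ?e = "Poly_Mapping.lookup m"
  have "((\<lambda>s. \<Prod>v\<in>UNIV. \<rho> s v ^ ?e v) has_real_derivative
    (\<Sum>v\<in>UNIV. (real (?e v) * (\<rho>' v * \<rho> s v ^ (?e v - Suc 0))) * (\<Prod>w\<in>UNIV - {v}. \<rho> s w ^ ?e w))) (at s within S)"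
    by (intro has_field_derivative_prod_within DERIV_power) (use assms in auto)
  moreover have "(real (?e v) * (\<rho>' v * \<rho> s v ^ (?e v - Suc 0))) * (\<Prod>w\<in>UNIV - {v}. \<rho> s w ^ ?e w)
      = \<rho>' v * (real (?e v) * monom_eval (\<rho> s) (m - Poly_Mapping.single v 1))" for v
  proof -
    have "monom_eval (\<rho> s) (m - Poly_Mapping.single v 1)
      = \<rho> s v ^ (?e v - Suc 0) * (\<Prod>w\<in>UNIV - {v}. \<rho> s w ^ ?e w)"
      by (subst prod.remove[of _ v]) (auto simp: lookup_minus lookup_single when_def intro!: prod.cong)
    then show ?thesis by simp
  qed
  ultimately show ?thesis by simp
qed

text \<open>The chain rule that links the formal derivative \<open>partial\<close> with analysis.
  Both sides are linear in \<open>p\<close>, so monomials suffice and no product rule for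
  \<open>partial\<close> is involved.\<close>

lemma has_real_derivative_ev:
  assumes "\<And>v. ((\<lambda>s. \<rho> s v) has_real_derivative \<rho>' v) (at s within S)"
  shows "((\<lambda>s. ev (\<rho> s) p) has_real_derivative
    (\<Sum>v\<in>UNIV. \<rho>' v * ev (\<rho> s) (partial v p))) (at s within S)"
proof -
  let ?c = "Poly_Mapping.lookup p"
  have "((\<lambda>s. ev (\<rho> s) p) has_real_derivative
    (\<Sum>m\<in>Poly_Mapping.keys p. ?c m * (\<Sum>v\<in>UNIV. \<rho>' v *
      (real (Poly_Mapping.lookup m v) * monom_eval (\<rho> s) (m - Poly_Mapping.single v 1))))) (at s within S)"
    unfolding ev_eq
    by (intro DERIV_sum DERIV_cmult has_real_derivative_monom_eval assms)
  also have "(\<Sum>m\<in>Poly_Mapping.keys p. ?c m * (\<Sum>v\<in>UNIV. \<rho>' v *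
      (real (Poly_Mapping.lookup m v) * monom_eval (\<rho> s) (m - Poly_Mapping.single v 1))))
     = (\<Sum>v\<in>UNIV. \<rho>' v * ev (\<rho> s) (partial v p))"
    unfolding partial_def ev_sum ev_single
    by (subst sum_distrib_left, subst sum.swap) (simp add: sum_distrib_left mult_ac)
  finally show ?thesis .
qed

text \<open>Substituting the linear polynomial \<open>[:\<alpha> v, \<beta> v:]\<close> for each
  variable gives a univariate polynomial, to which the finiteness of roots applies.\<close>

lemma ev_along_line:
  obtains q where "\<And>c. poly q c = ev (\<lambda>v. \<alpha> v + c * \<beta> v) p"
proof
  fix c
  show "poly (\<Sum>m\<in>Poly_Mapping.keys p. [:Poly_Mapping.lookup p m:] *
      (\<Prod>v\<in>UNIV. [:\<alpha> v, \<beta> v:] ^ Poly_Mapping.lookup m v)) c = ev (\<lambda>v. \<alpha> v + c * \<beta> v) p"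
    by (simp add: ev_eq poly_sum poly_prod)
qed

lemma eval_xtd_sos_nonneg: "p \<in> sos_in V \<Longrightarrow> eval_xtd p x t d \<ge> 0"
  unfolding eval_xtd_def by (rule ev_sos_nonneg)

text \<open>This and the next two lemmas reconcile the dummy value 0 in \<open>eval_xt\<close>,
  \<open>eval_xd\<close> and \<open>eval_d\<close> with evaluation of the polynomial identities at a
  full point \<open>(x, t, d)\<close>.\<close>

lemma eval_xtd_xt_vars: "p \<in> polys_in xt_vars \<Longrightarrow> eval_xtd p x t d = eval_xtd p x t d'"
  unfolding eval_xtd_def by (erule ev_cong_polys_in) auto

lemma eval_xtd_xd_vars: "p \<in> polys_in xd_vars \<Longrightarrow> eval_xtd p x t d = eval_xtd p x t' d"
  unfolding eval_xtd_def by (erule ev_cong_polys_in) auto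

lemma eval_xtd_d_vars: "p \<in> polys_in d_vars \<Longrightarrow> eval_xtd p x t d = eval_xtd p x' t' d"
  unfolding eval_xtd_def by (erule ev_cong_polys_in) auto

lemma eval_xtd_subst_time: "eval_xtd (subst_time T p) x t d = eval_xtd p x T d"
proof -
  have "(assignment x t d)(Time := T) = assignment x T d"
  proof
    fix v :: "('a, 'b) var" show "((assignment x t d)(Time := T)) v = assignment x T d v"
      by (cases v) auto
  qed
  then show ?thesis by (simp add: eval_xtd_def ev_subst_time)
qed

lemma polys_deg_le_subset: "polys_deg_le V k \<subseteq> polys_in V"
  by (auto simp: polys_deg_le_def)

lemma continuous_on_eval_xtd:
  assumes "continuous_on S \<xi>" "continuous_on S \<tau>" "continuous_on S \<delta>"
  shows "continuous_on S (\<lambda>z. eval_xtd p (\<xi> z) (\<tau> z) (\<delta> z))"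
  unfolding eval_xtd_def
proof (rule continuous_on_ev)
  fix v show "continuous_on S (\<lambda>z. assignment (\<xi> z) (\<tau> z) (\<delta> z) v)"
    by (cases v) (auto intro!: continuous_intros assms)
qed

lemma has_real_derivative_eval_xtd:
  assumes "(\<phi> has_vector_derivative \<phi>') (at s within S)"
  shows "((\<lambda>s. eval_xtd p (\<phi> s) s d) has_real_derivative
    eval_xtd (partial Time p) (\<phi> s) s d + (\<Sum>i\<in>UNIV. eval_xtd (partial (State i) p) (\<phi> s) s d * \<phi>' $ i))
    (at s within S)"
proof -
  \<comment> \<open>The velocity of the assignment is itself an assignment: time runs at speed 1 and
    the disturbance is frozen, hence speed 0.\<close>
  define \<rho>' where "\<rho>' = assignment \<phi>' 1 (0 :: real ^ 'b)"
  have i: "((\<lambda>s. \<phi> s $ i) has_real_derivative \<phi>' $ i) (at s within S)" for i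
    using bounded_linear.has_vector_derivative[OF bounded_linear_vec_nth assms, of i]
    by (simp add: has_real_derivative_iff_has_vector_derivative)
  have "((\<lambda>s. assignment (\<phi> s) s d v) has_real_derivative \<rho>' v) (at s within S)" for v
    by (cases v) (auto simp: \<rho>'_def i)
  from has_real_derivative_ev[of "\<lambda>s. assignment (\<phi> s) s d", OF this, of p]
  show ?thesis
    by (simp add: eval_xtd_def sum_UNIV_var \<rho>'_def mult.commute add.commute)
qed

section \<open>Absolutely continuous functions\<close>

text \<open>Tagged divisions are sets of pairs of a point and an interval. The definition indexes
  intervals by naturals below \<open>r\<close>, so the index set is enumerated by a
  bijection.\<close>

lemma abs_continuous_finite_family:
  assumes "abs_continuous a b y" "\<epsilon> > 0"
  shows "\<exists>\<delta>>0. \<forall>(I :: 'i set) p q. finite I \<and> (\<forall>i\<in>I. a \<le> p i \<and> p i \<le> q i \<and> q i \<le> b) \<and>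
       disjoint_family_on (\<lambda>i. {p i<..<q i}) I \<and> (\<Sum>i\<in>I. q i - p i) < \<delta>
       \<longrightarrow> (\<Sum>i\<in>I. norm (y (q i) - y (p i))) < \<epsilon>"
proof -
  obtain \<delta> where "\<delta> > 0" and \<delta>: "\<And>(r::nat) p q. (\<forall>i<r. a \<le> p i \<and> p i \<le> q i \<and> q i \<le> b) \<and>
        disjoint_family_on (\<lambda>i. {p i<..<q i}) {..<r} \<and> (\<Sum>i<r. q i - p i) < \<delta> \<Longrightarrow>
        (\<Sum>i<r. norm (y (q i) - y (p i))) < \<epsilon>"
    using assms unfolding abs_continuous_def by meson
  show ?thesis
  proof (intro exI[of _ \<delta>] conjI allI impI, fact)
    fix I :: "'i set" and p q
    assume *: "finite I \<and> (\<forall>i\<in>I. a \<le> p i \<and> p i \<le> q i \<and> q i \<le> b) \<and>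
      disjoint_family_on (\<lambda>i. {p i<..<q i}) I \<and> (\<Sum>i\<in>I. q i - p i) < \<delta>"
    then have I: "finite I" and pq: "\<And>i. i \<in> I \<Longrightarrow> a \<le> p i \<and> p i \<le> q i \<and> q i \<le> b"
      and disj: "disjoint_family_on (\<lambda>i. {p i<..<q i}) I" and less: "(\<Sum>i\<in>I. q i - p i) < \<delta>"
      by auto
    obtain e where e: "bij_betw e {..<card I} I"
      using ex_bij_betw_nat_finite[OF I] by (auto simp: atLeast0LessThan)
    have "(\<Sum>i<card I. norm (y (q (e i)) - y (p (e i)))) < \<epsilon>"
    proof (intro \<delta> conjI allI impI)
      fix i assume "i < card I"
      then have "e i \<in> I"
        using e bij_betwE by blast
      then show "a \<le> p (e i)" "p (e i) \<le> q (e i)" "q (e i) \<le> b"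
        using pq by auto
    next
      show "disjoint_family_on (\<lambda>i. {p (e i)<..<q (e i)}) {..<card I}"
        unfolding disjoint_family_on_def
      proof (intro ballI impI)
        fix i j assume ij: "i \<in> {..<card I}" "j \<in> {..<card I}" "i \<noteq> j"
        then have "e i \<in> I" "e j \<in> I" "e i \<noteq> e j"
          using e by (auto simp: bij_betw_def inj_on_def)
        then show "{p (e i)<..<q (e i)} \<inter> {p (e j)<..<q (e j)} = {}"
          using disj unfolding disjoint_family_on_def by blast
      qed
    next
      show "(\<Sum>i<card I. q (e i) - p (e i)) < \<delta>"
        using less sum.reindex_bij_betw[OF e, of "\<lambda>i. q i - p i"] by simp
    qed
    then show "(\<Sum>i\<in>I. norm (y (q i) - y (p i))) < \<epsilon>"
      using sum.reindex_bij_betw[OF e, of "\<lambda>i. norm (y (q i) - y (p i))"] by simp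
  qed
qed

lemma abs_continuous_subinterval:
  assumes "abs_continuous a b y" "a \<le> a'" "b' \<le> b"
  shows "abs_continuous a' b' y"
  unfolding abs_continuous_def
proof (intro allI impI)
  fix \<epsilon> :: real assume "\<epsilon> > 0"
  then obtain \<delta> where "\<delta> > 0" and \<delta>: "\<And>(r::nat) p q. (\<forall>i<r. a \<le> p i \<and> p i \<le> q i \<and> q i \<le> b) \<and>
        disjoint_family_on (\<lambda>i. {p i<..<q i}) {..<r} \<and> (\<Sum>i<r. q i - p i) < \<delta> \<Longrightarrow>
        (\<Sum>i<r. norm (y (q i) - y (p i))) < \<epsilon>"
    using assms(1) unfolding abs_continuous_def by meson
  show "\<exists>\<delta>>0. \<forall>(r::nat) p q. (\<forall>i<r. a' \<le> p i \<and> p i \<le> q i \<and> q i \<le> b') \<and>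
        disjoint_family_on (\<lambda>i. {p i<..<q i}) {..<r} \<and> (\<Sum>i<r. q i - p i) < \<delta> \<longrightarrow>
        (\<Sum>i<r. norm (y (q i) - y (p i))) < \<epsilon>"
  proof (intro exI[of _ \<delta>] conjI allI impI \<delta>)
    fix r :: nat and p q and i
    assume *: "(\<forall>i<r. a' \<le> p i \<and> p i \<le> q i \<and> q i \<le> b') \<and>
        disjoint_family_on (\<lambda>i. {p i<..<q i}) {..<r} \<and> (\<Sum>i<r. q i - p i) < \<delta>"
    show "disjoint_family_on (\<lambda>i. {p i<..<q i}) {..<r}" "(\<Sum>i<r. q i - p i) < \<delta>"
      using * by auto
    assume "i < r"
    with * show "a \<le> p i" "p i \<le> q i" "q i \<le> b"
      using assms(2,3) by force+
  qed fact
qed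

text \<open>The source of all closure properties below: each of them reduces to an estimate of one
  increment.\<close>

lemma abs_continuous_dominated:
  assumes f: "abs_continuous a b f" and g: "abs_continuous a b g"
    and h: "\<And>p q. \<lbrakk>a \<le> p; p \<le> q; q \<le> b\<rbrakk> \<Longrightarrow> norm (h q - h p) \<le> K * (norm (f q - f p) + norm (g q - g p))"
  shows "abs_continuous a b h"
  unfolding abs_continuous_def
proof (intro allI impI)
  fix \<epsilon> :: real assume "\<epsilon> > 0"
  \<comment> \<open>Adding 1 makes the constant positive whatever the sign of \<open>K\<close>, so
    that \<epsilon> can be divided by it.\<close>
  define L where "L = \<bar>K\<bar> + 1"
  define e where "e = \<epsilon> / (2 * L)"
  have "L > 0"
    by (simp add: L_def)
  then have "e > 0" and e: "L * (e + e) = \<epsilon>"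
    using \<open>\<epsilon> > 0\<close> by (auto simp: e_def field_simps)
  obtain \<delta>\<^sub>1 where "\<delta>\<^sub>1 > 0" and \<delta>\<^sub>1: "\<And>(r::nat) p q. (\<forall>i<r. a \<le> p i \<and> p i \<le> q i \<and> q i \<le> b) \<and>
        disjoint_family_on (\<lambda>i. {p i<..<q i}) {..<r} \<and> (\<Sum>i<r. q i - p i) < \<delta>\<^sub>1 \<Longrightarrow>
        (\<Sum>i<r. norm (f (q i) - f (p i))) < e"
    using f \<open>e > 0\<close> unfolding abs_continuous_def by meson
  obtain \<delta>\<^sub>2 where "\<delta>\<^sub>2 > 0" and \<delta>\<^sub>2: "\<And>(r::nat) p q. (\<forall>i<r. a \<le> p i \<and> p i \<le> q i \<and> q i \<le> b) \<and>
        disjoint_family_on (\<lambda>i. {p i<..<q i}) {..<r} \<and> (\<Sum>i<r. q i - p i) < \<delta>\<^sub>2 \<Longrightarrow>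
        (\<Sum>i<r. norm (g (q i) - g (p i))) < e"
    using g \<open>e > 0\<close> unfolding abs_continuous_def by meson
  show "\<exists>\<delta>>0. \<forall>(r::nat) p q. (\<forall>i<r. a \<le> p i \<and> p i \<le> q i \<and> q i \<le> b) \<and>
        disjoint_family_on (\<lambda>i. {p i<..<q i}) {..<r} \<and> (\<Sum>i<r. q i - p i) < \<delta> \<longrightarrow>
        (\<Sum>i<r. norm (h (q i) - h (p i))) < \<epsilon>"
  proof (intro exI[of _ "min \<delta>\<^sub>1 \<delta>\<^sub>2"] conjI allI impI)
    fix r :: nat and p q
    assume *: "(\<forall>i<r. a \<le> p i \<and> p i \<le> q i \<and> q i \<le> b) \<and>
        disjoint_family_on (\<lambda>i. {p i<..<q i}) {..<r} \<and> (\<Sum>i<r. q i - p i) < min \<delta>\<^sub>1 \<delta>\<^sub>2"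
    have "(\<Sum>i<r. norm (h (q i) - h (p i)))
        \<le> (\<Sum>i<r. L * (norm (f (q i) - f (p i)) + norm (g (q i) - g (p i))))"
    proof (rule sum_mono)
      fix i assume "i \<in> {..<r}"
      with * have "norm (h (q i) - h (p i)) \<le> K * (norm (f (q i) - f (p i)) + norm (g (q i) - g (p i)))"
        by (intro h) auto
      also have "\<dots> \<le> L * (norm (f (q i) - f (p i)) + norm (g (q i) - g (p i)))"
        by (rule mult_right_mono) (auto simp: L_def)
      finally show "norm (h (q i) - h (p i)) \<le> \<dots>" .
    qed
    also have "\<dots> = L * ((\<Sum>i<r. norm (f (q i) - f (p i))) + (\<Sum>i<r. norm (g (q i) - g (p i))))"
      by (simp add: sum.distrib flip: sum_distrib_left)
    also have "\<dots> < L * (e + e)"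
      using * by (intro mult_strict_left_mono add_strict_mono \<delta>\<^sub>1 \<delta>\<^sub>2 \<open>L > 0\<close>) auto
    finally show "(\<Sum>i<r. norm (h (q i) - h (p i))) < \<epsilon>"
      by (simp only: e)
  qed (use \<open>\<delta>\<^sub>1 > 0\<close> \<open>\<delta>\<^sub>2 > 0\<close> in auto)
qed

lemma abs_continuous_ident: "abs_continuous a b (\<lambda>s::real. s)"
  unfolding abs_continuous_def
proof (intro allI impI)
  fix \<epsilon> :: real assume "\<epsilon> > 0"
  then show "\<exists>\<delta>>0. \<forall>(r::nat) p q. (\<forall>i<r. a \<le> p i \<and> p i \<le> q i \<and> q i \<le> b) \<and>
        disjoint_family_on (\<lambda>i. {p i<..<q i}) {..<r} \<and> (\<Sum>i<r. q i - p i) < \<delta> \<longrightarrow>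
        (\<Sum>i<r. norm (q i - p i)) < \<epsilon>"
    by (intro exI[of _ \<epsilon>]) auto
qed

lemma abs_continuous_lipschitz:
  assumes "\<And>p q. \<lbrakk>a \<le> p; p \<le> q; q \<le> b\<rbrakk> \<Longrightarrow> norm (h q - h p) \<le> K * (q - p)"
  shows "abs_continuous a b h"
\<comment> \<open>The identity enters as both dominating functions, whence half the
  constant.\<close>
proof (rule abs_continuous_dominated[OF abs_continuous_ident abs_continuous_ident, where K = "K / 2"])
  fix p q assume "a \<le> p" "p \<le> q" "q \<le> b"
  then show "norm (h q - h p) \<le> K / 2 * (norm (q - p) + norm (q - p))"
    using assms[of p q] by (simp add: algebra_simps)
qed

lemma abs_continuous_const: "abs_continuous a b (\<lambda>s. c)"
  by (rule abs_continuous_lipschitz[where K = 0]) auto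

lemma abs_continuous_compose_lipschitz:
  assumes "abs_continuous a b f"
    and "\<And>p q. \<lbrakk>a \<le> p; p \<le> q; q \<le> b\<rbrakk> \<Longrightarrow> norm (h q - h p) \<le> K * norm (f q - f p)"
  shows "abs_continuous a b h"
proof (rule abs_continuous_dominated[OF assms(1,1), where K = "K / 2"])
  fix p q assume "a \<le> p" "p \<le> q" "q \<le> b"
  then show "norm (h q - h p) \<le> K / 2 * (norm (f q - f p) + norm (f q - f p))"
    using assms(2)[of p q] by simp
qed

lemma abs_continuous_imp_continuous_on:
  assumes "abs_continuous a b y"
  shows "continuous_on {a..b} y"
  unfolding continuous_on_iff
proof (intro ballI allI impI)
  fix x e :: real assume x: "x \<in> {a..b}" and "e > 0"
  obtain \<delta> where "\<delta> > 0" and \<delta>: "\<And>(r::nat) p q. (\<forall>i<r. a \<le> p i \<and> p i \<le> q i \<and> q i \<le> b) \<and>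
        disjoint_family_on (\<lambda>i. {p i<..<q i}) {..<r} \<and> (\<Sum>i<r. q i - p i) < \<delta> \<Longrightarrow>
        (\<Sum>i<r. norm (y (q i) - y (p i))) < e"
    using assms \<open>e > 0\<close> unfolding abs_continuous_def by meson
  have *: "norm (y q - y p) < e" if "a \<le> p" "p \<le> q" "q \<le> b" "q - p < \<delta>" for p q
    using \<delta>[of 1 "\<lambda>_. p" "\<lambda>_. q"] that by (simp add: disjoint_family_on_def)
  have "dist (y x') (y x) < e" if "x' \<in> {a..b}" "dist x' x < \<delta>" for x'
    using *[of x x'] *[of x' x] that x
    by (cases "x \<le> x'") (auto simp: dist_norm norm_minus_commute)
  then show "\<exists>d>0. \<forall>x'\<in>{a..b}. dist x' x < d \<longrightarrow> dist (y x') (y x) < e"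
    using \<open>\<delta> > 0\<close> by blast
qed

lemma abs_continuous_bounded:
  assumes "abs_continuous a b y"
  obtains M where "M > 0" "\<And>s. s \<in> {a..b} \<Longrightarrow> norm (y s) \<le> M"
proof -
  have "bounded (y ` {a..b})"
    by (intro compact_imp_bounded compact_continuous_image abs_continuous_imp_continuous_on assms) simp
  then show thesis
    using that unfolding bounded_pos by auto
qed

section \<open>Sums, products and powers of absolutely continuous functions\<close>

lemma abs_continuous_add:
  assumes "abs_continuous a b f" "abs_continuous a b g"
  shows "abs_continuous a b (\<lambda>s. f s + g s)"
  by (rule abs_continuous_dominated[OF assms, where K = 1])
     (metis add_diff_add mult_1 norm_triangle_ineq)

lemma abs_continuous_diff:
  assumes "abs_continuous a b f" "abs_continuous a b g"
  shows "abs_continuous a b (\<lambda>s. f s - g s)"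
proof (rule abs_continuous_dominated[OF assms, where K = 1])
  fix p q
  have "norm (f q - g q - (f p - g p)) = norm ((f q - f p) - (g q - g p))"
    by (simp add: algebra_simps)
  then show "norm (f q - g q - (f p - g p)) \<le> 1 * (norm (f q - f p) + norm (g q - g p))"
    using norm_triangle_ineq4 by (metis mult_1)
qed

text \<open>The increment splits as for the product rule, and both factors are bounded on the
  compact interval. Multiplication and the inner product are the instances used.\<close>

lemma abs_continuous_bilinear:
  assumes B: "bounded_bilinear B" and f: "abs_continuous a b f" and g: "abs_continuous a b g"
  shows "abs_continuous a b (\<lambda>s. B (f s) (g s))"
proof -
  interpret bounded_bilinear B by fact
  obtain K where "K > 0" and K: "\<And>x y. norm (B x y) \<le> norm x * norm y * K"
    using pos_bounded by blast
  obtain M where "M > 0" and M: "\<And>s. s \<in> {a..b} \<Longrightarrow> norm (f s) \<le> M"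
    using abs_continuous_bounded[OF f] by blast
  obtain M' where "M' > 0" and M': "\<And>s. s \<in> {a..b} \<Longrightarrow> norm (g s) \<le> M'"
    using abs_continuous_bounded[OF g] by blast
  show ?thesis
  proof (rule abs_continuous_dominated[OF f g, where K = "(M + M') * K"])
    fix p q assume "a \<le> p" "p \<le> q" "q \<le> b"
    then have pq: "p \<in> {a..b}" "q \<in> {a..b}" by auto
    have "B (f q) (g q) - B (f p) (g p) = B (f q) (g q - g p) + B (f q - f p) (g p)"
      by (simp add: diff_left diff_right)
    then have "norm (B (f q) (g q) - B (f p) (g p))
        \<le> norm (f q) * norm (g q - g p) * K + norm (f q - f p) * norm (g p) * K"
      by (metis K add_mono norm_triangle_le)
    also have "\<dots> \<le> (M + M') * norm (g q - g p) * K + norm (f q - f p) * (M + M') * K"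
      using M[OF pq(2)] M'[OF pq(1)] \<open>K > 0\<close> \<open>M > 0\<close> \<open>M' > 0\<close>
      by (intro add_mono mult_right_mono mult_left_mono) auto
    finally show "norm (B (f q) (g q) - B (f p) (g p))
        \<le> (M + M') * K * (norm (f q - f p) + norm (g q - g p))"
      by (simp add: algebra_simps)
  qed
qed

lemmas abs_continuous_mult = abs_continuous_bilinear[OF bounded_bilinear_mult]
lemmas abs_continuous_inner = abs_continuous_bilinear[OF bounded_bilinear_inner]

lemma abs_continuous_power:
  fixes f :: "real \<Rightarrow> real"
  assumes "abs_continuous a b f"
  shows "abs_continuous a b (\<lambda>s. f s ^ k)"
  by (induction k) (auto intro: abs_continuous_const abs_continuous_mult assms)

lemma abs_continuous_sum:
  assumes "\<And>i. i \<in> I \<Longrightarrow> abs_continuous a b (f i)"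
  shows "abs_continuous a b (\<lambda>s. \<Sum>i\<in>I. f i s)"
  using assms
  by (induction I rule: infinite_finite_induct) (auto intro: abs_continuous_const abs_continuous_add)

lemma abs_continuous_prod:
  fixes f :: "'i \<Rightarrow> real \<Rightarrow> real"
  assumes "\<And>i. i \<in> I \<Longrightarrow> abs_continuous a b (f i)"
  shows "abs_continuous a b (\<lambda>s. \<Prod>i\<in>I. f i s)"
  using assms
  by (induction I rule: infinite_finite_induct) (auto intro: abs_continuous_const abs_continuous_mult)

lemma abs_continuous_vec_nth:
  fixes f :: "real \<Rightarrow> real ^ 'n"
  assumes "abs_continuous a b f"
  shows "abs_continuous a b (\<lambda>s. f s $ i)"
proof (rule abs_continuous_compose_lipschitz[OF assms, where K = 1])
  fix p q
  show "norm (f q $ i - f p $ i) \<le> 1 * norm (f q - f p)"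
    using component_le_norm_cart[of "f q - f p" i] by simp
qed

text \<open>A bounded derivative gives a Lipschitz estimate. The function serves as the integrating
  factor in Gronwall's inequality.\<close>

lemma abs_continuous_exp: "abs_continuous a b (\<lambda>s. exp (c * s :: real))"
proof -
  have "continuous_on {a..b} (\<lambda>s. c * exp (c * s))"
    by (intro continuous_intros)
  then have "bounded ((\<lambda>s. c * exp (c * s)) ` {a..b})"
    by (intro compact_imp_bounded compact_continuous_image) auto
  then obtain M where M: "\<And>s. s \<in> {a..b} \<Longrightarrow> norm (c * exp (c * s)) \<le> M"
    unfolding bounded_iff by (metis imageI)
  show ?thesis
  proof (rule abs_continuous_lipschitz)
    fix p q assume pq: "a \<le> p" "p \<le> q" "q \<le> b"
    have "norm (exp (c * q) - exp (c * p)) \<le> M * norm (q - p)"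
    proof (rule field_differentiable_bound)
      show "convex {a..b}" "p \<in> {a..b}" "q \<in> {a..b}"
        using pq by auto
      show "((\<lambda>s. exp (c * s)) has_field_derivative c * exp (c * s)) (at s within {a..b})" for s
        by (auto intro!: derivative_eq_intros)
    qed (rule M)
    then show "norm (exp (c * q) - exp (c * p)) \<le> M * (q - p)"
      using pq by simp
  qed
qed

text \<open>Cousin's lemma: intervals tagged outside \<open>N\<close> are short enough for the derivative to control
  the increment, those tagged in \<open>N\<close> lie in an open set of small measure, where absolute continuity
  controls the sum of the increments.\<close>

lemma abs_continuous_nonincreasing:
  fixes z :: "real \<Rightarrow> real"
  assumes "a \<le> b" and z: "abs_continuous a b z" and N: "negligible N"
    and deriv: "\<And>s. s \<in> {a..b} - N \<Longrightarrow> \<exists>z'\<le>0. (z has_real_derivative z') (at s within {a..b})"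
  shows "z b \<le> z a"
proof (rule field_le_epsilon)
  fix e :: real assume "e > 0"
  \<comment> \<open>Half of \<open>e\<close> is reserved for each kind of tag. The summand 1 avoids
    a zero denominator when \<open>a = b\<close>.\<close>
  define e1 where "e1 = e / (2 * (b - a + 1))"
  have "e1 > 0" and e1: "e1 * (b - a) \<le> e / 2"
    using \<open>e > 0\<close> \<open>a \<le> b\<close> by (auto simp: e1_def field_simps)
  obtain \<delta> where "\<delta> > 0" and \<delta>: "\<forall>(I :: (real \<times> real set) set) p q. finite I \<and>
       (\<forall>i\<in>I. a \<le> p i \<and> p i \<le> q i \<and> q i \<le> b) \<and>
       disjoint_family_on (\<lambda>i. {p i<..<q i}) I \<and> (\<Sum>i\<in>I. q i - p i) < \<delta>
       \<longrightarrow> (\<Sum>i\<in>I. norm (z (q i) - z (p i))) < e / 2"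
    using abs_continuous_finite_family[OF z half_gt_zero[OF \<open>e > 0\<close>], where ?'i = "real \<times> real set"]
    by (elim exE conjE) (rule that)
  obtain U where "open U" "N \<subseteq> U" and U: "emeasure lebesgue (U - N) < ennreal \<delta>"
    using sets_lebesgue_outer_open[OF negligible_imp_sets[OF N] \<open>\<delta> > 0\<close>] by metis
  \<comment> \<open>The outer approximation bounds only the excess \<open>U - N\<close>; since
    \<open>N\<close> is null, it bounds all of \<open>U\<close>.\<close>
  have "emeasure lebesgue (U - N) = emeasure lebesgue U"
    using N \<open>open U\<close> by (intro emeasure_Diff_null_set) (auto simp: negligible_iff_null_sets)
  then have "U \<in> lmeasurable"
    using U \<open>open U\<close> by (intro fmeasurableI) (auto simp: less_top[symmetric])
  have "measure lebesgue U < \<delta>"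
    using U \<open>emeasure lebesgue (U - N) = _\<close> emeasure_eq_measure2[OF \<open>U \<in> lmeasurable\<close>] \<open>\<delta> > 0\<close>
    by (simp add: ennreal_less_iff)
  \<comment> \<open>The condition on \<open>s\<close> is a premise under the quantifiers, so that a
    radius exists for every real \<open>s\<close> and can be chosen as a function.\<close>
  have "\<exists>d>0. \<forall>u v. s \<in> {a..b} - N \<and> a \<le> u \<and> u \<le> s \<and> s \<le> v \<and> v \<le> b \<and> {u..v} \<subseteq> ball s d \<longrightarrow> z v - z u \<le> e1 * (v - u)" for s
  proof (cases "s \<in> {a..b} - N")
    case True
    then obtain z' where "z' \<le> 0" and z': "(z has_real_derivative z') (at s within {a..b})"
      using deriv by blast
    obtain d where "d > 0" and d: "\<And>y. \<lbrakk>y \<in> {a..b}; norm (y - s) < d\<rbrakk> \<Longrightarrow> norm (z y - z s - z' * (y - s)) \<le> e1 * norm (y - s)"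
      using z' \<open>e1 > 0\<close> unfolding has_field_derivative_def has_derivative_within_alt by blast
    show ?thesis
    proof (intro exI[of _ d] conjI allI impI)
      fix u v assume *: "s \<in> {a..b} - N \<and> a \<le> u \<and> u \<le> s \<and> s \<le> v \<and> v \<le> b \<and> {u..v} \<subseteq> ball s d"
      then have "u \<in> {u..v}" "v \<in> {u..v}" by auto
      with * have "u \<in> ball s d" "v \<in> ball s d" by blast+
      \<comment> \<open>The tag lies between the endpoints, so the errors on its two sides add up to
        exactly \<open>e1 * (v - u)\<close>.\<close>
      then have "\<bar>z v - z s - z' * (v - s)\<bar> \<le> e1 * (v - s)" "\<bar>z u - z s - z' * (u - s)\<bar> \<le> e1 * (s - u)"
        using d[of u] d[of v] * by (auto simp: dist_real_def)
      then have "z v - z u \<le> z' * (v - s) - z' * (u - s) + e1 * (v - u)"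
        by (simp add: algebra_simps abs_le_iff)
      moreover have "z' * (v - u) \<le> 0"
        using \<open>z' \<le> 0\<close> * by (simp add: mult_nonpos_nonneg)
      ultimately show "z v - z u \<le> e1 * (v - u)"
        by (simp add: algebra_simps)
    qed fact
  qed (use zero_less_one in blast)
  then obtain d where dpos: "\<And>s. d s > 0"
    and d: "\<And>s u v. \<lbrakk>s \<in> {a..b} - N; a \<le> u; u \<le> s; s \<le> v; v \<le> b; {u..v} \<subseteq> ball s (d s)\<rbrakk> \<Longrightarrow> z v - z u \<le> e1 * (v - u)"
    by metis
  define \<gamma> where "\<gamma> = (\<lambda>s. if s \<in> N then U else ball s (d s))"
  have "gauge \<gamma>"
    using \<open>open U\<close> \<open>N \<subseteq> U\<close> dpos by (auto simp: gauge_def \<gamma>_def)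
  then obtain P where P: "P tagged_division_of {a..b}" and fine: "\<gamma> fine P"
    using fine_division_exists_real by blast
  have "finite P"
    using P by (rule tagged_division_of_finite)
  have PD: "a \<le> Inf k \<and> Inf k \<le> x \<and> x \<le> Sup k \<and> Sup k \<le> b \<and> k = {Inf k..Sup k} \<and> k \<subseteq> \<gamma> x \<and> x \<in> {a..b}"
    if xk: "(x, k) \<in> P" for x k
  proof -
    obtain u v where k: "k = cbox u v"
      using tagged_division_ofD(4)[OF P xk] by blast
    moreover have "x \<in> k" "k \<subseteq> {a..b}" "k \<subseteq> \<gamma> x"
      using tagged_division_ofD(2,3)[OF P xk] fineD[OF fine xk] by auto
    ultimately show ?thesis
      by auto
  qed
  define P\<^sub>N where "P\<^sub>N = {i \<in> P. fst i \<in> N}"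
  have disj: "disjoint_family_on (\<lambda>i. {Inf (snd i)<..<Sup (snd i)}) P\<^sub>N"
    unfolding disjoint_family_on_def
  proof (intro ballI impI)
    fix i j assume ij: "i \<in> P\<^sub>N" "j \<in> P\<^sub>N" "i \<noteq> j"
    obtain x k x' k' where eq: "i = (x, k)" "j = (x', k')"
      by (cases i, cases j)
    have xk: "(x, k) \<in> P" "(x', k') \<in> P" "(x, k) \<noteq> (x', k')"
      using ij by (auto simp: P\<^sub>N_def eq)
    have "interior k \<inter> interior k' = {}"
      using tagged_division_ofD(5)[OF P xk] .
    moreover have "interior k = {Inf k<..<Sup k}" "interior k' = {Inf k'<..<Sup k'}"
      using PD[OF xk(1)] PD[OF xk(2)] interior_atLeastAtMost_real by metis+
    ultimately show "{Inf (snd i)<..<Sup (snd i)} \<inter> {Inf (snd j)<..<Sup (snd j)} = {}"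
      by (simp add: eq)
  qed
  have "(\<Sum>i\<in>P\<^sub>N. Sup (snd i) - Inf (snd i)) = (\<Sum>i\<in>P\<^sub>N. measure lebesgue {Inf (snd i)<..<Sup (snd i)})"
    by (rule sum.cong) (use PD in \<open>force simp: P\<^sub>N_def\<close>)+
  also have "\<dots> = measure lebesgue (\<Union>i\<in>P\<^sub>N. {Inf (snd i)<..<Sup (snd i)})"
  proof (rule measure_finite_Union[symmetric])
    show "emeasure lebesgue {Inf (snd i)<..<Sup (snd i)} \<noteq> \<infinity>" for i :: "real \<times> real set"
      using lmeasurable_box[of "Inf (snd i)" "Sup (snd i)"] fmeasurableD2 by (metis box_real(1) infinity_ennreal_def)
  qed (use \<open>finite P\<close> disj in \<open>auto simp: P\<^sub>N_def\<close>)
  also have "\<dots> \<le> measure lebesgue U"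
  proof (rule measure_mono_fmeasurable)
    show "(\<Union>i\<in>P\<^sub>N. {Inf (snd i)<..<Sup (snd i)}) \<subseteq> U"
    proof (intro UN_least subsetI)
      fix i y assume "i \<in> P\<^sub>N" "y \<in> {Inf (snd i)<..<Sup (snd i)}"
      then show "y \<in> U"
        using PD[of "fst i" "snd i"] by (auto simp: P\<^sub>N_def \<gamma>_def)
    qed
    show "(\<Union>i\<in>P\<^sub>N. {Inf (snd i)<..<Sup (snd i)}) \<in> sets lebesgue"
      using \<open>finite P\<close> by (intro sets.finite_UN) (auto simp: P\<^sub>N_def)
  qed fact
  finally have "(\<Sum>i\<in>P\<^sub>N. Sup (snd i) - Inf (snd i)) < \<delta>"
    using \<open>measure lebesgue U < \<delta>\<close> by simp
  then have bad: "(\<Sum>i\<in>P\<^sub>N. norm (z (Sup (snd i)) - z (Inf (snd i)))) < e / 2"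
    using \<open>finite P\<close> disj PD by (intro \<delta>[rule_format] conjI ballI) (fastforce simp: P\<^sub>N_def)+
  have good: "(\<Sum>i\<in>P - P\<^sub>N. z (Sup (snd i)) - z (Inf (snd i))) \<le> e / 2"
  proof -
    have "(\<Sum>i\<in>P - P\<^sub>N. z (Sup (snd i)) - z (Inf (snd i))) \<le> (\<Sum>i\<in>P - P\<^sub>N. e1 * (Sup (snd i) - Inf (snd i)))"
    proof (rule sum_mono)
      fix i assume i: "i \<in> P - P\<^sub>N"
      then have "(fst i, snd i) \<in> P" "fst i \<notin> N"
        by (auto simp: P\<^sub>N_def)
      then show "z (Sup (snd i)) - z (Inf (snd i)) \<le> e1 * (Sup (snd i) - Inf (snd i))"
        using PD[of "fst i" "snd i"] by (intro d[of "fst i"]) (auto simp: \<gamma>_def)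
    qed
    \<comment> \<open>Lengths are nonnegative; over the full division they telescope to
      \<open>b - a\<close>.\<close>
    also have "\<dots> \<le> (\<Sum>i\<in>P. e1 * (Sup (snd i) - Inf (snd i)))"
      by (rule sum_mono2) (use \<open>finite P\<close> \<open>e1 > 0\<close> PD in \<open>force+\<close>)
    also have "\<dots> = e1 * (\<Sum>(x, k)\<in>P. Sup k - Inf k)"
      by (simp add: sum_distrib_left case_prod_unfold)
    also have "\<dots> = e1 * (b - a)"
      using additive_tagged_division_1[OF \<open>a \<le> b\<close> P, of "\<lambda>s. s"] by simp
    finally show ?thesis
      using e1 by simp
  qed
  have "z b - z a = (\<Sum>i\<in>P. z (Sup (snd i)) - z (Inf (snd i)))"
    using additive_tagged_division_1[OF \<open>a \<le> b\<close> P, of z] by (simp add: case_prod_unfold)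
  also have "\<dots> = (\<Sum>i\<in>P - P\<^sub>N. z (Sup (snd i)) - z (Inf (snd i))) + (\<Sum>i\<in>P\<^sub>N. z (Sup (snd i)) - z (Inf (snd i)))"
    by (rule sum.subset_diff) (use \<open>finite P\<close> in \<open>auto simp: P\<^sub>N_def\<close>)
  also have "(\<Sum>i\<in>P\<^sub>N. z (Sup (snd i)) - z (Inf (snd i))) \<le> (\<Sum>i\<in>P\<^sub>N. norm (z (Sup (snd i)) - z (Inf (snd i))))"
    by (rule sum_mono) auto
  finally show "z b \<le> z a + e"
    using bad good by simp
qed

lemma AE_lebesgue_on_iff_negligible:
  "(AE s in lebesgue_on {a..b::real}. P s) \<longleftrightarrow> (\<exists>N. negligible N \<and> (\<forall>s\<in>{a..b} - N. P s))"
proof -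
  have "(AE s in lebesgue_on {a..b}. P s) \<longleftrightarrow> (AE s in lebesgue. s \<in> {a..b} \<longrightarrow> P s)"
    by (rule AE_restrict_space_iff) simp
  also have "\<dots> \<longleftrightarrow> (\<exists>N\<in>null_sets lebesgue. {s. \<not> (s \<in> {a..b} \<longrightarrow> P s)} \<subseteq> N)"
    by (simp add: eventually_ae_filter)
  finally show ?thesis
    unfolding negligible_iff_null_sets by blast
qed

text \<open>Multiplying by the integrating factor \<open>exp (- K * s)\<close> turns the
  differential inequality into a nonpositive derivative, so the monotonicity criterion applies.
  Neither \<open>z\<close> nor \<open>K\<close> needs a sign.\<close>

lemma abs_continuous_gronwall:
  fixes z :: "real \<Rightarrow> real"
  assumes "a \<le> b" and z: "abs_continuous a b z" and N: "negligible N"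
    and deriv: "\<And>s. s \<in> {a..b} - N \<Longrightarrow> \<exists>z'\<le>K * z s. (z has_real_derivative z') (at s within {a..b})"
  shows "z b \<le> exp (K * (b - a)) * z a"
proof -
  have "exp (- K * b) * z b \<le> exp (- K * a) * z a"
  proof (rule abs_continuous_nonincreasing[OF \<open>a \<le> b\<close> _ N])
    show "abs_continuous a b (\<lambda>s. exp (- K * s) * z s)"
      by (intro abs_continuous_mult abs_continuous_exp z)
    fix s assume "s \<in> {a..b} - N"
    then obtain z' where "z' \<le> K * z s" and z': "(z has_real_derivative z') (at s within {a..b})"
      using deriv by blast
    have "((\<lambda>s. exp (- K * s) * z s) has_real_derivative exp (- K * s) * (z' - K * z s)) (at s within {a..b})"
      by (auto intro!: derivative_eq_intros z' simp: algebra_simps)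
    moreover have "exp (- K * s) * (z' - K * z s) \<le> 0"
      using \<open>z' \<le> K * z s\<close> by (simp add: mult_nonneg_nonpos)
    ultimately show "\<exists>z'\<le>0. ((\<lambda>s. exp (- K * s) * z s) has_real_derivative z') (at s within {a..b})"
      by blast
  qed
  then have "exp (K * b) * (exp (- K * b) * z b) \<le> exp (K * b) * (exp (- K * a) * z a)"
    by simp
  then show ?thesis
    by (simp add: algebra_simps exp_diff exp_minus field_simps)
qed

section \<open>Caratheodory solutions\<close>

text \<open>On the line, averages over cubes with lower corner \<open>s\<close> are difference
  quotients from the right. The form with \<open>e * h\<close> matches the definition of a
  derivative without division.\<close>

lemma right_derivative_indefinite_integral_AE:
  fixes g :: "real \<Rightarrow> 'a::euclidean_space"
  assumes "\<And>a b. g integrable_on {a..b}"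
  obtains N where "negligible N"
    "\<And>s e. \<lbrakk>s \<notin> N; 0 < e\<rbrakk> \<Longrightarrow> \<exists>d>0. \<forall>h. 0 < h \<and> h < d \<longrightarrow> norm (integral {s..s + h} g - h *\<^sub>R g s) \<le> e * h"
proof -
  obtain N where N: "negligible N"
    and right: "\<And>s e. \<lbrakk>s \<notin> N; 0 < e\<rbrakk> \<Longrightarrow> \<exists>d>0. \<forall>h. 0 < h \<and> h < d \<longrightarrow>
      norm (integral (cbox s (s + h *\<^sub>R One)) g /\<^sub>R h ^ DIM(real) - g s) < e"
    using integrable_ccontinuous_explicit[of g] assms by (metis box_real(2))
  show thesis
  proof
    fix s e :: real assume "s \<notin> N" "0 < e"
    then obtain d where "d > 0" and d: "\<And>h. 0 < h \<and> h < d \<Longrightarrow>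
      norm (integral (cbox s (s + h *\<^sub>R One)) g /\<^sub>R h ^ DIM(real) - g s) < e"
      using right by blast
    have "norm (integral {s..s + h} g - h *\<^sub>R g s) \<le> e * h" if "0 < h \<and> h < d" for h
    proof -
      have "integral {s..s + h} g - h *\<^sub>R g s = h *\<^sub>R (integral {s..s + h} g /\<^sub>R h - g s)"
        using that by (simp add: scaleR_diff_right)
      moreover have "norm (integral {s..s + h} g /\<^sub>R h - g s) < e"
        using d[OF that] by simp
      ultimately show ?thesis
        using that by (simp add: mult.commute[of e])
    qed
    with \<open>d > 0\<close> show "\<exists>d>0. \<forall>h. 0 < h \<and> h < d \<longrightarrow> norm (integral {s..s + h} g - h *\<^sub>R g s) \<le> e * h"
      by blast
  qed (rule N)
qed

text \<open>Lebesgue's differentiation theorem on the line: the derivative from the left is the derivative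
  from the right of the reflected function.\<close>

lemma has_vector_derivative_indefinite_integral_AE:
  fixes g :: "real \<Rightarrow> 'a::euclidean_space"
  assumes g: "\<And>a b. g integrable_on {a..b}"
  obtains N where "negligible N"
    "\<And>s. s \<in> {a..b} - N \<Longrightarrow> ((\<lambda>s. integral {a..s} g) has_vector_derivative g s) (at s within {a..b})"
proof -
  obtain N where N: "negligible N"
    and right: "\<And>s e. \<lbrakk>s \<notin> N; 0 < e\<rbrakk> \<Longrightarrow> \<exists>d>0. \<forall>h. 0 < h \<and> h < d \<longrightarrow> norm (integral {s..s + h} g - h *\<^sub>R g s) \<le> e * h"
    using right_derivative_indefinite_integral_AE[OF g] by blast
  have "(\<lambda>s. g (- s)) integrable_on {a..b}" for a b
    using g[of "- b" "- a"] Henstock_Kurzweil_Integration.integrable_reflect_real[of g "- a" "- b"] by simp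
  then obtain N' where N': "negligible N'"
    and left: "\<And>s e. \<lbrakk>s \<notin> N'; 0 < e\<rbrakk> \<Longrightarrow> \<exists>d>0. \<forall>h. 0 < h \<and> h < d \<longrightarrow>
      norm (integral {s..s + h} (\<lambda>s. g (- s)) - h *\<^sub>R g (- s)) \<le> e * h"
    using right_derivative_indefinite_integral_AE[of "\<lambda>s. g (- s)"] by metis
  show thesis
  proof
    show "negligible (N \<union> uminus ` N')"
      by (intro negligible_Un N negligible_differentiable_image_negligible N') (auto intro!: differentiable_on_minus differentiable_on_id)
    fix s assume s: "s \<in> {a..b} - (N \<union> uminus ` N')"
    then have "s \<notin> N" "- s \<notin> N'"
      by (auto simp: image_iff)
    show "((\<lambda>s. integral {a..s} g) has_vector_derivative g s) (at s within {a..b})"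
      unfolding has_vector_derivative_def has_derivative_within_alt
    proof (intro conjI allI impI)
      show "bounded_linear (\<lambda>h. h *\<^sub>R g s)"
        by (rule bounded_linear_scaleR_left)
      fix e :: real assume "0 < e"
      obtain d where "d > 0" and d: "\<And>h. 0 < h \<and> h < d \<Longrightarrow> norm (integral {s..s + h} g - h *\<^sub>R g s) \<le> e * h"
        using right[OF \<open>s \<notin> N\<close> \<open>0 < e\<close>] by blast
      obtain d' where "d' > 0" and d': "\<And>h. 0 < h \<and> h < d' \<Longrightarrow>
          norm (integral {- s..- s + h} (\<lambda>s. g (- s)) - h *\<^sub>R g (- (- s))) \<le> e * h"
        using left[OF \<open>- s \<notin> N'\<close> \<open>0 < e\<close>] by blast
      have "norm (integral {a..r} g - integral {a..s} g - (r - s) *\<^sub>R g s) \<le> e * norm (r - s)"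
        if r: "r \<in> {a..b}" "norm (r - s) < min d d'" for r
      proof (cases r s rule: linorder_cases)
        case greater
        have "integral {a..r} g = integral {a..s} g + integral {s..r} g"
          using Henstock_Kurzweil_Integration.integral_combine[OF _ _ g, of a s r] s greater by auto
        then show ?thesis
          using d[of "r - s"] r greater by simp
      next
        case less
        have "integral {a..s} g = integral {a..r} g + integral {r..s} g"
          using Henstock_Kurzweil_Integration.integral_combine[OF _ _ g, of a r s] r less by auto
        moreover have "integral {- s..- s + (s - r)} (\<lambda>s. g (- s)) = integral {r..s} g"
          using Henstock_Kurzweil_Integration.integral_reflect_real[of s r g] by simp
        ultimately show ?thesis
          using d'[of "s - r"] r less by (simp add: norm_minus_commute algebra_simps)
      qed simp
      then show "\<exists>d>0. \<forall>r\<in>{a..b}. norm (r - s) < d \<longrightarrow>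
          norm (integral {a..r} g - integral {a..s} g - (r - s) *\<^sub>R g s) \<le> e * norm (r - s)"
        using \<open>d > 0\<close> \<open>d' > 0\<close> by (intro exI[of _ "min d d'"]) auto
    qed
  qed
qed

section \<open>Existence of solutions by a fixed point argument\<close>

lemma abs_continuous_indefinite_integral:
  fixes g :: "real \<Rightarrow> 'a::euclidean_space"
  assumes g: "\<And>a b. g integrable_on {a..b}" and M: "\<And>s. norm (g s) \<le> M"
  shows "abs_continuous a b (\<lambda>s. integral {a..s} g)"
proof (rule abs_continuous_lipschitz)
  fix p q assume "a \<le> p" "p \<le> q" "q \<le> b"
  then have "integral {a..q} g - integral {a..p} g = integral {p..q} g"
    using Henstock_Kurzweil_Integration.integral_combine[OF _ _ g, of a p q] by (auto simp: algebra_simps)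
  moreover have "norm (integral {p..q} g) \<le> integral {p..q} (\<lambda>_. M)"
    by (rule integral_norm_bound_integral) (use g M in auto)
  ultimately show "norm (integral {a..q} g - integral {a..p} g) \<le> M * (q - p)"
    using \<open>p \<le> q\<close> by (simp add: mult.commute)
qed

text \<open>With the weight \<open>exp (2 * L * s)\<close>, integrating the Lipschitz bound
  reproduces the weight with factor 1/2, the contraction constant of the Picard operator.\<close>

lemma integral_exp_le:
  fixes L :: real
  assumes "L > 0" "0 \<le> \<tau>"
  shows "(\<lambda>s. L * exp (2 * L * s)) integrable_on {0..\<tau>}"
    and "integral {0..\<tau>} (\<lambda>s. L * exp (2 * L * s)) \<le> exp (2 * L * \<tau>) / 2"
proof -
  have *: "((\<lambda>s. L * exp (2 * L * s)) has_integral exp (2 * L * \<tau>) / 2 - exp (2 * L * 0) / 2) {0..\<tau>}"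
    using assms(2)
    by (rule fundamental_theorem_of_calculus)
       (auto intro!: derivative_eq_intros simp flip: has_real_derivative_iff_has_vector_derivative)
  then show "(\<lambda>s. L * exp (2 * L * s)) integrable_on {0..\<tau>}"
    by (rule has_integral_integrable)
  show "integral {0..\<tau>} (\<lambda>s. L * exp (2 * L * s)) \<le> exp (2 * L * \<tau>) / 2"
    unfolding integral_unique[OF *] by simp
qed

text \<open>The integrand is extended by 0 because the differentiation theorem above asks for
  integrability on every interval. The bound comes from compactness of the image of \<open>y\<close>
  and of \<open>D\<close>.\<close>

lemma input_integrand_integrable:
  fixes F :: "real ^ 'n \<Rightarrow> real ^ 'm \<Rightarrow> real ^ 'n"
  assumes F: "continuous_on (UNIV \<times> D) (\<lambda>(x, d). F x d)" and D: "compact D"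
    and d: "d \<in> inputs D T 0" and y: "continuous_on {0..T} y"
  defines "g \<equiv> \<lambda>s. if s \<in> {0..T} then F (y s) (d s) else 0"
  shows "\<exists>M. \<forall>s. norm (g s) \<le> M" and "g integrable_on {a..b}"
proof -
  have dD: "d s \<in> D" if "s \<in> {0..T}" for s
    using d that by (auto simp: inputs_def)
  have "compact ((\<lambda>(x, d). F x d) ` (y ` {0..T} \<times> D))"
    by (intro compact_continuous_image compact_Times compact_continuous_image[OF y] D)
       (auto intro: continuous_on_subset[OF F])
  then obtain M where "M > 0" and M: "\<And>s. s \<in> {0..T} \<Longrightarrow> norm (F (y s) (d s)) \<le> M"
    using dD by (auto dest!: compact_imp_bounded simp: bounded_pos)
  then have gM: "norm (g s) \<le> M" for s
    by (auto simp: g_def)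
  then show "\<exists>M. \<forall>s. norm (g s) \<le> M"
    by blast
  \<comment> \<open>\<open>F\<close> is continuous only for disturbances in \<open>D\<close>. Cut
    off by the indicator of a closed set it is Borel on the whole space, so it can be composed with
    the Lebesgue measurable pair of \<open>y\<close> and \<open>d\<close>.\<close>
  have "(\<lambda>z. indicator (UNIV \<times> D) z *\<^sub>R (case z of (x, d) \<Rightarrow> F x d)) \<in> borel_measurable borel"
    by (rule borel_measurable_continuous_on_indicator[OF _ F])
       (intro borel_closed closed_Times closed_UNIV compact_imp_closed D)
  moreover have "y \<in> borel_measurable (lebesgue_on {0..T})"
    using y by (rule continuous_imp_measurable_on_sets_lebesgue) simp
  moreover have "d \<in> borel_measurable (lebesgue_on {0..T})"
    using d by (simp add: inputs_def)
  ultimately have "(\<lambda>s. indicator (UNIV \<times> D) (y s, d s) *\<^sub>R (case (y s, d s) of (x, d) \<Rightarrow> F x d))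
      \<in> borel_measurable (lebesgue_on {0..T})"
    by (intro measurable_compose[OF borel_measurable_Pair])
  then have "(\<lambda>s. F (y s) (d s)) \<in> borel_measurable (lebesgue_on {0..T})"
    by (rule measurable_cong[THEN iffD1, rotated]) (use dD in auto)
  then have "g \<in> borel_measurable lebesgue"
    unfolding g_def by (subst borel_measurable_if) auto
  then show "g integrable_on {a..b}"
    using measurable_bounded_lemma[of g "\<lambda>_. M" a b] gM integrable_const[of M a b] by simp
qed

text \<open>Banach's fixed point theorem for the Picard operator in bounded continuous functions. An
  exponentially weighted norm (Bielecki) makes it a contraction on the whole interval at once,
  however large \<open>T * L\<close> is.\<close>

lemma caratheodory_existence:
  fixes F :: "real ^ 'n \<Rightarrow> real ^ 'm \<Rightarrow> real ^ 'n"
  assumes "0 \<le> T" and F: "continuous_on (UNIV \<times> D) (\<lambda>(x, d). F x d)" and D: "compact D"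
    and L: "L > 0" and lip: "\<And>d x x'. d \<in> D \<Longrightarrow> norm (F x d - F x' d) \<le> L * norm (x - x')"
    and d: "d \<in> inputs D T 0"
  obtains y where "solution F T x 0 d y"
proof -
  have dD: "d s \<in> D" if "s \<in> {0..T}" for s
    using d that by (auto simp: inputs_def)
  \<comment> \<open>Instead of changing the norm, the unknown is rescaled: the trajectory is
    \<open>w s *\<^sub>R \<psi> s\<close>, and \<psi> is measured in the usual sup norm.\<close>
  define w where "w = (\<lambda>s. exp (2 * L * s))"
  have w: "w s > 0" for s
    by (simp add: w_def)
  define G where "G = (\<lambda>(\<psi> :: real \<Rightarrow>\<^sub>C (real ^ 'n)) s.
      if s \<in> {0..T} then F (w s *\<^sub>R \<psi> s) (d s) else 0)"
  have cont: "continuous_on S (\<lambda>s. w s *\<^sub>R \<psi> s)" for S and \<psi> :: "real \<Rightarrow>\<^sub>C (real ^ 'n)"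
    unfolding w_def by (intro continuous_intros) auto
  have G_bounded: "\<exists>M. \<forall>s. norm (G \<psi> s) \<le> M" and G_integrable: "G \<psi> integrable_on {a..b}" for \<psi> a b
    unfolding G_def by (rule input_integrand_integrable[OF F D d cont])+
  define q where "q = (\<lambda>\<psi> t. (x + integral {0..t} (G \<psi>)) /\<^sub>R w t)"
  have q_cont: "continuous_on (cbox 0 T) (q \<psi>)" for \<psi>
    unfolding q_def w_def
    by (intro continuous_intros) (auto intro: indefinite_integral_continuous_1 G_integrable)
  \<comment> \<open>Elements of the function space live on the whole line, so the image of the
    operator is continued by constants outside \<open>{0..T}\<close> by means of
    \<open>clamp\<close>.\<close>
  have "\<exists>Q :: real \<Rightarrow>\<^sub>C (real ^ 'n). \<forall>t. Q t = q \<psi> (clamp 0 T t)" for \<psi>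
    using continuous_on_cbox_bcontfunE[OF q_cont[of \<psi>]] by metis
  then obtain Q where Q: "\<And>\<psi> t. apply_bcontfun (Q \<psi>) t = q \<psi> (clamp 0 T t)"
    by metis
  have "dist (Q \<psi>) (Q \<psi>') \<le> 1 / 2 * dist \<psi> \<psi>'" for \<psi> \<psi>'
  proof (rule dist_bound)
    fix t
    define \<tau> where "\<tau> = clamp 0 T t"
    have \<tau>: "\<tau> \<in> {0..T}"
      using clamp_in_interval[of 0 T t] \<open>0 \<le> T\<close> by (auto simp: \<tau>_def)
    have "norm (integral {0..\<tau>} (\<lambda>s. G \<psi> s - G \<psi>' s)) \<le> integral {0..\<tau>} (\<lambda>s. (L * exp (2 * L * s)) * dist \<psi> \<psi>')"
    proof (rule integral_norm_bound_integral)
      show "(\<lambda>s. G \<psi> s - G \<psi>' s) integrable_on {0..\<tau>}"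
        by (intro integrable_diff G_integrable)
      show "(\<lambda>s. (L * exp (2 * L * s)) * dist \<psi> \<psi>') integrable_on {0..\<tau>}"
        using integral_exp_le(1)[OF L] \<tau> by (intro integrable_on_mult_left) auto
      fix s assume "s \<in> {0..\<tau>}"
      then have s: "s \<in> {0..T}"
        using \<tau> by auto
      have "norm (G \<psi> s - G \<psi>' s) \<le> L * norm (w s *\<^sub>R \<psi> s - w s *\<^sub>R \<psi>' s)"
        using lip[OF dD[OF s]] s by (simp add: G_def)
      also have "\<dots> = (L * w s) * dist (\<psi> s) (\<psi>' s)"
        using w[of s] by (simp add: dist_norm flip: scaleR_diff_right)
      also have "\<dots> \<le> (L * w s) * dist \<psi> \<psi>'"
        using w[of s] L by (intro mult_left_mono dist_bounded) auto
      finally show "norm (G \<psi> s - G \<psi>' s) \<le> (L * exp (2 * L * s)) * dist \<psi> \<psi>'"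
        by (simp add: w_def)
    qed
    also have "\<dots> = integral {0..\<tau>} (\<lambda>s. L * exp (2 * L * s)) * dist \<psi> \<psi>'"
      by (rule integral_mult_left)
    also have "\<dots> \<le> w \<tau> / 2 * dist \<psi> \<psi>'"
      using integral_exp_le(2)[OF L] \<tau> by (intro mult_right_mono) (auto simp: w_def)
    finally have "norm (integral {0..\<tau>} (G \<psi>) - integral {0..\<tau>} (G \<psi>')) \<le> w \<tau> * (1 / 2 * dist \<psi> \<psi>')"
      by (simp add: integral_diff G_integrable)
    moreover have "w \<tau> * dist (Q \<psi> t) (Q \<psi>' t) = norm (integral {0..\<tau>} (G \<psi>) - integral {0..\<tau>} (G \<psi>'))"
      using w[of \<tau>] by (simp add: Q q_def dist_norm flip: \<tau>_def scaleR_diff_right)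
    ultimately have "w \<tau> * dist (Q \<psi> t) (Q \<psi>' t) \<le> w \<tau> * (1 / 2 * dist \<psi> \<psi>')"
      by simp
    then show "dist (Q \<psi> t) (Q \<psi>' t) \<le> 1 / 2 * dist \<psi> \<psi>'"
      by (rule mult_left_le_imp_le[OF _ w])
  qed
  then obtain \<psi> where \<psi>: "Q \<psi> = \<psi>"
    using banach_fix_type[of "1 / 2" Q] by auto
  \<comment> \<open>The integral form gives absolute continuity and the derivative directly; it
    agrees with the rescaled fixed point only on \<open>{0..T}\<close>.\<close>
  define y where "y = (\<lambda>t. x + integral {0..t} (G \<psi>))"
  have y: "y t = w t *\<^sub>R \<psi> t" if "t \<in> {0..T}" for t
  proof -
    have "\<psi> t = q \<psi> t"
      using Q[of \<psi> t] that \<psi> by simp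
    then show ?thesis
      using w[of t] by (simp add: q_def y_def)
  qed
  obtain N where N: "negligible N" and deriv: "\<And>s. s \<in> {0..T} - N \<Longrightarrow>
      ((\<lambda>s. integral {0..s} (G \<psi>)) has_vector_derivative G \<psi> s) (at s within {0..T})"
    by (rule has_vector_derivative_indefinite_integral_AE[where a = 0 and b = T, OF G_integrable[of \<psi>]]) blast
  have "solution F T x 0 d y"
    unfolding solution_def
  proof (intro conjI)
    obtain M where "\<And>s. norm (G \<psi> s) \<le> M"
      using G_bounded by blast
    then show "abs_continuous 0 T y"
      unfolding y_def
      by (intro abs_continuous_add abs_continuous_const abs_continuous_indefinite_integral G_integrable)
    show "y 0 = x"
      by (simp add: y_def)
    have "(y has_vector_derivative F (y s) (d s)) (at s within {0..T})" if "s \<in> {0..T} - N" for s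
      using deriv[OF that] y[of s] that
      by (auto simp: y_def G_def intro!: derivative_eq_intros)
    with N show "AE s in lebesgue_on {0..T}. (y has_vector_derivative F (y s) (d s)) (at s within {0..T})"
      unfolding AE_lebesgue_on_iff_negligible by blast
  qed
  then show thesis ..
qed

section \<open>Uniqueness of solutions and a priori bounds\<close>

lemma solution_deriv:
  assumes "solution F T x t d y"
  obtains N where "negligible N"
    "\<And>s. s \<in> {t..T} - N \<Longrightarrow> (y has_vector_derivative F (y s) (d s)) (at s within {t..T})"
  using assms unfolding solution_def AE_lebesgue_on_iff_negligible by blast

text \<open>Gronwall for the squared distance, which, unlike the norm, is differentiable where the
  solutions meet. It vanishes at time \<open>t\<close> and its derivative is at most
  \<open>2 * L\<close> times itself.\<close>

lemma solution_unique:
  fixes F :: "real ^ 'n \<Rightarrow> real ^ 'm \<Rightarrow> real ^ 'n"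
  assumes lip: "\<And>d x x'. d \<in> D \<Longrightarrow> norm (F x d - F x' d) \<le> L * norm (x - x')"
    and d: "d \<in> inputs D T t"
    and y: "solution F T x t d y" and y': "solution F T x t d y'"
    and "r \<in> {t..T}"
  shows "y r = y' r"
proof -
  obtain N where N: "negligible N" and deriv: "\<And>s. s \<in> {t..T} - N \<Longrightarrow>
      (y has_vector_derivative F (y s) (d s)) (at s within {t..T})"
    by (rule solution_deriv[OF y]) blast
  obtain N' where N': "negligible N'" and deriv': "\<And>s. s \<in> {t..T} - N' \<Longrightarrow>
      (y' has_vector_derivative F (y' s) (d s)) (at s within {t..T})"
    by (rule solution_deriv[OF y']) blast
  define z where "z = (\<lambda>s. (y s - y' s) \<bullet> (y s - y' s))"
  have "abs_continuous t T y" "abs_continuous t T y'"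
    using y y' by (auto simp: solution_def)
  then have "abs_continuous t r z"
    unfolding z_def using \<open>r \<in> {t..T}\<close>
    by (intro abs_continuous_inner abs_continuous_diff) (auto elim: abs_continuous_subinterval)
  moreover have "\<exists>z'\<le>2 * L * z s. (z has_real_derivative z') (at s within {t..r})"
    if "s \<in> {t..r} - (N \<union> N')" for s
  proof -
    have s: "s \<in> {t..T} - N" "s \<in> {t..T} - N'" "s \<in> {t..T}"
      using that \<open>r \<in> {t..T}\<close> by auto
    have sub: "{t..r} \<subseteq> {t..T}"
      using \<open>r \<in> {t..T}\<close> by auto
    let ?v = "F (y s) (d s) - F (y' s) (d s)"
    have "((\<lambda>s. y s - y' s) has_vector_derivative ?v) (at s within {t..r})"
      by (intro has_vector_derivative_diff has_vector_derivative_within_subset[OF deriv[OF s(1)] sub]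
          has_vector_derivative_within_subset[OF deriv'[OF s(2)] sub])
    from bounded_bilinear.has_vector_derivative[OF bounded_bilinear_inner this this]
    have "(z has_real_derivative 2 * ((y s - y' s) \<bullet> ?v)) (at s within {t..r})"
      by (simp add: z_def has_real_derivative_iff_has_vector_derivative inner_commute)
    moreover have "(y s - y' s) \<bullet> ?v \<le> norm (y s - y' s) * (L * norm (y s - y' s))"
      using d s(3)
      by (intro order_trans[OF norm_cauchy_schwarz mult_left_mono] lip) (auto simp: inputs_def)
    ultimately show ?thesis
      by (intro exI[of _ "2 * ((y s - y' s) \<bullet> ?v)"])
         (auto simp: z_def dot_square_norm power2_eq_square algebra_simps)
  qed
  ultimately have "z r \<le> exp (2 * L * (r - t)) * z t"
    using \<open>r \<in> {t..T}\<close> N N' by (intro abs_continuous_gronwall[where N = "N \<union> N'"]) auto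
  moreover have "z t = 0"
    using y y' by (simp add: z_def solution_def)
  ultimately have "(y r - y' r) \<bullet> (y r - y' r) \<le> 0"
    by (simp add: z_def)
  then show ?thesis
    by (metis inner_gt_zero_iff eq_iff_diff_eq_0 not_le)
qed

text \<open>Gronwall for \<open>1 + y s \<bullet> y s\<close>, using the linear growth of
  \<open>F\<close>. What counts is that \<open>B\<close> is chosen before the input: it makes the
  set of costs bounded above.\<close>

lemma solution_bounded:
  fixes F :: "real ^ 'n \<Rightarrow> real ^ 'm \<Rightarrow> real ^ 'n"
  assumes F: "continuous_on (UNIV \<times> D) (\<lambda>(x, d). F x d)" and D: "compact D"
    and L: "L \<ge> 0" and lip: "\<And>d x x'. d \<in> D \<Longrightarrow> norm (F x d - F x' d) \<le> L * norm (x - x')"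
  obtains B where "\<And>d y r. \<lbrakk>d \<in> inputs D T t; solution F T x t d y; r \<in> {t..T}\<rbrakk> \<Longrightarrow> norm (y r) \<le> B"
proof -
  have "compact ((\<lambda>(x, d). F x d) ` ({0} \<times> D))"
    by (intro compact_continuous_image compact_Times D) (auto intro: continuous_on_subset[OF F])
  then obtain C where "C > 0" and C: "\<And>d. d \<in> D \<Longrightarrow> norm (F 0 d) \<le> C"
    by (auto dest!: compact_imp_bounded simp: bounded_pos)
  \<comment> \<open>Half the derivative is at most \<open>n * (L * n + C)\<close> with
    \<open>n\<close> the norm of the state; the bound of \<open>2 * n\<close> by
    \<open>1 + n\<^sup>2\<close> leads to this rate.\<close>
  define K where "K = C + 2 * L"
  define B where "B = exp (K * (T - t)) * (1 + x \<bullet> x)"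
  have "norm (y r) \<le> sqrt B"
    if d: "d \<in> inputs D T t" and y: "solution F T x t d y" and r: "r \<in> {t..T}" for d y r
  proof -
    obtain N where N: "negligible N" and deriv: "\<And>s. s \<in> {t..T} - N \<Longrightarrow>
        (y has_vector_derivative F (y s) (d s)) (at s within {t..T})"
      by (rule solution_deriv[OF y]) blast
    define z where "z = (\<lambda>s. 1 + y s \<bullet> y s)"
    have "abs_continuous t T y"
      using y by (simp add: solution_def)
    then have "abs_continuous t r z"
      unfolding z_def using r
      by (intro abs_continuous_add abs_continuous_const abs_continuous_inner)
         (auto elim: abs_continuous_subinterval)
    moreover have "\<exists>z'\<le>K * z s. (z has_real_derivative z') (at s within {t..r})"
      if "s \<in> {t..r} - N" for s
    proof -
      have s: "s \<in> {t..T} - N" "d s \<in> D" and sub: "{t..r} \<subseteq> {t..T}"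
        using that r d by (auto simp: inputs_def)
      let ?v = "F (y s) (d s)" and ?n = "norm (y s)"
      have dy: "(y has_vector_derivative ?v) (at s within {t..r})"
        by (rule has_vector_derivative_within_subset[OF deriv[OF s(1)] sub])
      from bounded_bilinear.has_vector_derivative[OF bounded_bilinear_inner dy dy]
      have "((\<lambda>s. y s \<bullet> y s) has_real_derivative 2 * (y s \<bullet> ?v)) (at s within {t..r})"
        by (simp add: has_real_derivative_iff_has_vector_derivative inner_commute)
      then have "(z has_real_derivative 2 * (y s \<bullet> ?v)) (at s within {t..r})"
        unfolding z_def by (auto intro!: derivative_eq_intros)
      moreover have "2 * (y s \<bullet> ?v) \<le> K * z s"
      proof -
        have "norm ?v \<le> norm (F (y s) (d s) - F 0 (d s)) + norm (F 0 (d s))"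
          using norm_triangle_ineq[of "F (y s) (d s) - F 0 (d s)" "F 0 (d s)"] by simp
        also have "\<dots> \<le> L * ?n + C"
          using lip[OF s(2), of "y s" 0] C[OF s(2)] by simp
        finally have "?n * norm ?v \<le> ?n * (L * ?n + C)"
          by (intro mult_left_mono) auto
        then have "2 * (y s \<bullet> ?v) \<le> 2 * (?n * (L * ?n + C))"
          using norm_cauchy_schwarz[of "y s" ?v] by linarith
        also have "\<dots> = 2 * L * ?n\<^sup>2 + C * (2 * ?n)"
          by (simp add: power2_eq_square algebra_simps)
        also have "\<dots> \<le> 2 * L * (1 + ?n\<^sup>2) + C * (1 + ?n\<^sup>2)"
          using L \<open>C > 0\<close> sum_squares_bound[of 1 ?n]
          by (intro add_mono mult_left_mono) (auto simp: power2_eq_square)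
        finally show ?thesis
          by (simp add: z_def K_def dot_square_norm algebra_simps)
      qed
      ultimately show ?thesis by blast
    qed
    ultimately have "z r \<le> exp (K * (r - t)) * z t"
      using r N by (intro abs_continuous_gronwall) auto
    also have "\<dots> \<le> B"
      using r y L \<open>C > 0\<close> unfolding B_def z_def
      by (intro mult_mono) (auto simp: solution_def K_def)
    finally show ?thesis
      by (intro real_le_rsqrt) (simp add: z_def dot_square_norm)
  qed
  then show thesis ..
qed

section \<open>Zero sets of polynomials\<close>

text \<open>If every line through \<open>a\<close> meets \<open>S\<close> in finitely many points, then every point lies in only
  finitely many of the dilations of \<open>S\<close> about \<open>a\<close> by the factors \<open>1 + 1 / (n + 1)\<close>. For bounded
  \<open>S\<close> these all have at least the measure of \<open>S\<close> and lie in one bounded set.\<close>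

lemma negligible_finite_on_lines:
  fixes S :: "'a::euclidean_space set"
  assumes "closed S" and fin: "\<And>v. finite {c::real. a + c *\<^sub>R v \<in> S}"
  shows "negligible S"
  unfolding negligible_on_intervals[of S]
proof (intro allI)
  fix u v :: 'a
  define K where "K = S \<inter> cbox u v"
  have "compact K"
    unfolding K_def using assms(1) by (intro closed_Int_compact compact_cbox)
  define \<kappa> where "\<kappa> = (\<lambda>n. 1 + inverse (real (Suc n)))"
  \<comment> \<open>The lower bound keeps dilations from losing measure, the upper bound keeps them
    in one ball.\<close>
  have \<kappa>: "1 \<le> \<kappa> n" "\<kappa> n \<le> 2" for n
    by (auto simp: \<kappa>_def field_simps)
  define A where "A = (\<lambda>n. (\<lambda>x. \<kappa> n *\<^sub>R x + (1 - \<kappa> n) *\<^sub>R a) ` K)"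
  \<comment> \<open>The sets \<open>B n\<close> decrease to the set of points lying in infinitely
    many \<open>A i\<close>, which will be empty; continuity from above then sends their measures to
    0.\<close>
  define B where "B = (\<lambda>n. \<Union>i\<in>{n..}. A i)"
  have A_sets: "A n \<in> sets lebesgue" for n
  proof -
    have "compact (A n)"
      unfolding A_def by (intro compact_continuous_image \<open>compact K\<close> continuous_intros)
    then show ?thesis
      by (simp add: compact_imp_closed)
  qed
  have B_sets: "B n \<in> sets lebesgue" for n
    unfolding B_def using A_sets by (intro sets.countable_UN') auto
  obtain M where M: "\<And>x. x \<in> K \<Longrightarrow> norm x \<le> M"
    using compact_imp_bounded[OF \<open>compact K\<close>] by (auto simp: bounded_iff)
  have "B n \<subseteq> cball 0 (2 * M + norm a)" for n
  proof
    fix y assume "y \<in> B n"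
    then obtain i x where "x \<in> K" and y: "y = \<kappa> i *\<^sub>R x + (1 - \<kappa> i) *\<^sub>R a"
      by (auto simp: B_def A_def)
    have "norm y \<le> \<kappa> i * norm x + \<bar>1 - \<kappa> i\<bar> * norm a"
      unfolding y using \<kappa>[of i] by (intro norm_triangle_le) simp
    also have "\<dots> \<le> 2 * M + 1 * norm a"
      using \<kappa>[of i] M[OF \<open>x \<in> K\<close>] by (intro add_mono mult_mono) auto
    finally show "y \<in> cball 0 (2 * M + norm a)"
      by simp
  qed
  then have "B n \<in> lmeasurable" for n
    using bounded_subset[OF bounded_cball] B_sets by (metis bounded_set_imp_lmeasurable)
  then have B_fin: "emeasure lebesgue (B n) \<noteq> \<infinity>" for n
    using fmeasurableD2 by (metis infinity_ennreal_def)
  have "(\<Inter>n. B n) = {}"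
  proof (rule ccontr)
    assume "(\<Inter>n. B n) \<noteq> {}"
    then obtain y where y: "\<And>n. y \<in> B n"
      by auto
    \<comment> \<open>Undoing the dilation moves \<open>y\<close> along its line through
      \<open>a\<close> to a point of \<open>S\<close> with parameter
      \<open>inverse (\<kappa> i)\<close>. Different \<open>i\<close> give different
      parameters.\<close>
    have "(\<lambda>i. inverse (\<kappa> i)) ` {i. y \<in> A i} \<subseteq> {c. a + c *\<^sub>R (y - a) \<in> S}"
    proof
      fix c assume "c \<in> (\<lambda>i. inverse (\<kappa> i)) ` {i. y \<in> A i}"
      then obtain i x where c: "c = inverse (\<kappa> i)" and "x \<in> K" and y: "y = \<kappa> i *\<^sub>R x + (1 - \<kappa> i) *\<^sub>R a"
        by (auto simp: A_def)
      have "y - a = \<kappa> i *\<^sub>R (x - a)"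
        by (simp add: y algebra_simps)
      then have "a + c *\<^sub>R (y - a) = x"
        using \<kappa>[of i] by (simp add: c)
      then show "c \<in> {c. a + c *\<^sub>R (y - a) \<in> S}"
        using \<open>x \<in> K\<close> by (simp add: K_def)
    qed
    then have "finite ((\<lambda>i. inverse (\<kappa> i)) ` {i. y \<in> A i})"
      using fin finite_subset by blast
    moreover have "inj_on (\<lambda>i. inverse (\<kappa> i)) {i. y \<in> A i}"
      by (auto simp: inj_on_def \<kappa>_def)
    ultimately have "finite {i. y \<in> A i}"
      by (rule finite_imageD)
    then obtain m where "\<And>i. y \<in> A i \<Longrightarrow> i < m"
      using finite_nat_set_iff_bounded by auto
    then show False
      using y[of m] by (force simp: B_def)
  qed
  moreover have "(\<lambda>n. emeasure lebesgue (B n)) \<longlonglongrightarrow> emeasure lebesgue (\<Inter>n. B n)"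
  proof (rule Lim_emeasure_decseq)
    show "decseq B"
      unfolding B_def decseq_def by (intro allI impI UN_mono) auto
  qed (use B_sets B_fin in auto)
  ultimately have "(\<lambda>n. emeasure lebesgue (B n)) \<longlonglongrightarrow> 0"
    by simp
  moreover have "emeasure lebesgue K \<le> emeasure lebesgue (B n)" for n
  proof -
    have "ennreal 1 * emeasure lebesgue K \<le> ennreal (\<bar>\<kappa> n\<bar> ^ DIM('a)) * emeasure lebesgue K"
      using \<kappa>[of n] by (intro mult_right_mono ennreal_leI) auto
    also have "\<dots> = emeasure lebesgue (A n)"
      unfolding A_def by (simp add: emeasure_lebesgue_affine ennreal_power)
    also have "\<dots> \<le> emeasure lebesgue (B n)"
      using B_sets by (intro emeasure_mono) (auto simp: B_def)
    finally show ?thesis by simp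
  qed
  ultimately have "emeasure lebesgue K \<le> 0"
    by (intro LIMSEQ_le_const) auto
  then have "emeasure lebesgue K = 0"
    by simp
  then have "K \<in> null_sets lebesgue"
    using \<open>compact K\<close> by (intro null_setsI) (auto simp: compact_imp_closed)
  then show "negligible (S \<inter> cbox u v)"
    by (simp add: negligible_iff_null_sets K_def)
qed

text \<open>The lines are taken through the point \<open>x\<close> where \<open>p\<close> does not
  vanish: the restriction of \<open>p\<close> to each of them is a nonzero univariate polynomial and
  has finitely many roots.\<close>

lemma negligible_eval_xtd_zeros:
  assumes "eval_xtd p x t d \<noteq> 0"
  shows "negligible {y. eval_xtd p y t d = 0}"
proof (rule negligible_finite_on_lines)
  show "closed {y. eval_xtd p y t d = 0}"
    by (intro closed_Collect_eq continuous_on_eval_xtd continuous_intros)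
next
  fix v
  obtain q where q: "\<And>c. poly q c = ev (\<lambda>w. assignment x t d w + c * assignment v 0 0 w) p"
    using ev_along_line by blast
  have "assignment x t d w + c * assignment v 0 0 w = assignment (x + c *\<^sub>R v) t d w" for c w
    by (cases w) auto
  then have q': "poly q c = eval_xtd p (x + c *\<^sub>R v) t d" for c
    by (simp add: q eval_xtd_def)
  have "q \<noteq> 0"
    using assms q'[of 0] by auto
  then show "finite {c. x + c *\<^sub>R v \<in> {y. eval_xtd p y t d = 0}}"
    using poly_roots_finite[of q] by (simp add: q')
qed

section \<open>The reachable set and the value function\<close>

lemma ev_gR: "ev (assignment x t d) (gR R) = R - (norm x)\<^sup>2"
  by (simp add: gR_def norm_vec_def L2_set_def sum_nonneg)

lemma ballR_eq_cball: "ballR R = cball 0 (sqrt R)"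
proof (rule set_eqI)
  fix x :: "real ^ 'n"
  show "x \<in> ballR R \<longleftrightarrow> x \<in> cball 0 (sqrt R)"
    unfolding mem_cball_0 by (simp add: ballR_def norm_vec_def L2_set_def)
qed

lemma mem_ballR: "x \<in> ballR R \<longleftrightarrow> (norm x)\<^sup>2 \<le> R"
  by (simp add: ballR_def norm_vec_def L2_set_def sum_nonneg)

text \<open>Replaces the suprema by pointwise inequalities. Continuity of \<phi> on the compact
  interval makes the real suprema bounded and hence meaningful.\<close>

lemma cost_le_iff:
  assumes "0 \<le> T" "nX \<ge> 1" "nTR \<ge> 1" and \<phi>: "continuous_on {0..T} \<phi>"
  shows "cost nX g nTR l T 0 \<phi> \<le> c \<longleftrightarrow>
    (\<forall>j\<in>{1..nTR}. eval_x (l j) (\<phi> T) \<le> c) \<and> (\<forall>i\<in>{1..nX}. \<forall>s\<in>{0..T}. eval_xt (g i) (\<phi> s) s \<le> c)"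
proof -
  have "(SUP s\<in>{0..T}. eval_xt (g i) (\<phi> s) s) \<le> c \<longleftrightarrow> (\<forall>s\<in>{0..T}. eval_xt (g i) (\<phi> s) s \<le> c)" for i
  proof (rule cSUP_le_iff)
    show "bdd_above ((\<lambda>s. eval_xt (g i) (\<phi> s) s) ` {0..T})"
      by (intro bounded_imp_bdd_above compact_imp_bounded compact_continuous_image
          continuous_on_eval_xtd \<phi> continuous_intros) auto
  qed (use \<open>0 \<le> T\<close> in auto)
  then show ?thesis
    using assms(2,3) unfolding cost_def by (simp add: Max_le_iff)
qed

text \<open>\<open>L\<close> is one Lipschitz constant for all disturbances, taken strictly positive
  as the existence theorem requires.\<close>

locale constrained_system =
  fixes f :: "'n::finite \<Rightarrow> ('n, 'm::finite) rpoly"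
    and h g l :: "nat \<Rightarrow> ('n, 'm) rpoly"
    and F :: "real ^ 'n \<Rightarrow> real ^ 'm \<Rightarrow> real ^ 'n"
    and nD nX nTR :: nat
    and T R L :: real
  assumes T_pos: "T > 0" and nX: "nX \<ge> 1" and nTR: "nTR \<ge> 1"
    and f_vars: "\<And>i. f i \<in> polys_in xd_vars"
    and h_vars: "\<And>i. i \<in> {1..nD} \<Longrightarrow> h i \<in> polys_in d_vars"
    and D_nonempty: "dist_set nD h \<noteq> {}" and D_compact: "compact (dist_set nD h)"
    and R_pos: "R > 0"
    and X_subset: "\<And>t. t \<in> {0..T} \<Longrightarrow> state_set nX g t \<subseteq> ballR R"
    and X_boundary: "\<And>t. t \<in> {0..T} \<Longrightarrow> state_set_boundary nX g t \<inter> frontier (ballR R) = {}"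
    and F_cont: "continuous_on (UNIV \<times> dist_set nD h) (\<lambda>(x, d). F x d)"
    and L_pos: "L > 0"
    and F_lip: "\<And>d x x'. d \<in> dist_set nD h \<Longrightarrow> norm (F x d - F x' d) \<le> L * norm (x - x')"
    and F_eq: "\<And>x d. x \<in> ballR R \<Longrightarrow> d \<in> dist_set nD h \<Longrightarrow> F x d = vector_field f x d"
begin

abbreviation "D \<equiv> dist_set nD h"
abbreviation "X \<equiv> state_set nX g"
abbreviation "value0 x \<equiv> value_fun F D nX g nTR l T x 0"
abbreviation "reach \<equiv> reach_set (vector_field f) D T X (target_set nTR l)"
abbreviation "sos \<equiv> sos_constraints T R f nD h nX g nTR l"

text \<open>A point of \<open>X t\<close> on the sphere would satisfy all constraints strictly, by
  disjointness from the boundary. Strict inequalities persist on an open set, which lies in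
  \<open>X t\<close> and so in the ball, making the point interior to the ball.\<close>

lemma X_strict:
  assumes t: "t \<in> {0..T}" and x: "x \<in> X t"
  shows "(norm x)\<^sup>2 < R"
proof (rule ccontr)
  assume "\<not> (norm x)\<^sup>2 < R"
  then have "norm x = sqrt R"
    using X_subset[OF t] x by (auto simp: mem_ballR intro!: real_sqrt_unique[symmetric])
  then have "x \<in> frontier (ballR R)"
    by (simp add: ballR_eq_cball)
  then have *: "eval_xt (g i) x t < 0" if "i \<in> {1..nX}" for i
    using X_boundary[OF t] x that by (force simp: state_set_boundary_def state_set_def less_le)
  let ?U = "\<Inter>i\<in>{1..nX}. {y. eval_xt (g i) y t < 0}"
  have "open ?U"
    by (intro open_INT ballI open_Collect_less continuous_on_eval_xtd continuous_intros) auto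
  moreover have "?U \<subseteq> ballR R"
    using X_subset[OF t] by (force simp: state_set_def)
  ultimately have "x \<in> interior (ballR R)"
    using * by (intro interiorI[of ?U]) auto
  with \<open>x \<in> frontier (ballR R)\<close> show False
    by (simp add: frontier_def)
qed

text \<open>On the ball and for times in \<open>{0..T}\<close> the weights \<open>gR R\<close> and
  \<open>t * (T - t)\<close> are nonnegative, so the certificate evaluates to a sum of nonnegative
  terms. The next two lemmas use the same argument.\<close>

lemma eval_g_le:
  assumes "sos \<psi>" "x \<in> ballR R" "t \<in> {0..T}" "i \<in> {1..nX}"
  shows "eval_xt (g i) x t \<le> eval_xt \<psi> x t"
proof -
  obtain s\<^sub>3 s\<^sub>4 s\<^sub>5 where s: "s\<^sub>3 \<in> sos_in xt_vars" "s\<^sub>4 \<in> sos_in xt_vars" "s\<^sub>5 \<in> sos_in xt_vars"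
    and eq: "\<psi> - g i = s\<^sub>3 + s\<^sub>4 * gR R + s\<^sub>5 * (Var Time * (Const T - Var Time))"
    using assms(1,4) unfolding sos_constraints_def by blast
  have "eval_xt \<psi> x t - eval_xt (g i) x t
      = eval_xt s\<^sub>3 x t + eval_xt s\<^sub>4 x t * (R - (norm x)\<^sup>2) + eval_xt s\<^sub>5 x t * (t * (T - t))"
    using arg_cong[OF eq, of "\<lambda>p. eval_xt p x t"]
    by (simp add: eval_xtd_def ev_gR)
  moreover have "\<dots> \<ge> 0"
    using assms(2,3) by (intro add_nonneg_nonneg mult_nonneg_nonneg eval_xtd_sos_nonneg[OF s(1)]
        eval_xtd_sos_nonneg[OF s(2)] eval_xtd_sos_nonneg[OF s(3)]) (auto simp: mem_ballR)
  ultimately show ?thesis by simp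
qed

lemma eval_l_le:
  assumes "sos \<psi>" "x \<in> ballR R" "j \<in> {1..nTR}"
  shows "eval_x (l j) x \<le> eval_xt \<psi> x T"
proof -
  obtain s\<^sub>6 s\<^sub>7 where s: "s\<^sub>6 \<in> sos_in x_vars" "s\<^sub>7 \<in> sos_in x_vars"
    and eq: "subst_time T \<psi> - l j = s\<^sub>6 + s\<^sub>7 * gR R"
    using assms(1,3) unfolding sos_constraints_def by blast
  have "eval_x (subst_time T \<psi>) x - eval_x (l j) x = eval_x s\<^sub>6 x + eval_x s\<^sub>7 x * (R - (norm x)\<^sup>2)"
    using arg_cong[OF eq, of "\<lambda>p. eval_x p x"]
    by (simp add: eval_xtd_def ev_gR)
  moreover have "\<dots> \<ge> 0"
    using assms(2) by (intro add_nonneg_nonneg mult_nonneg_nonneg eval_xtd_sos_nonneg[OF s(1)]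
        eval_xtd_sos_nonneg[OF s(2)]) (auto simp: mem_ballR)
  ultimately show ?thesis
    by (simp add: eval_xtd_subst_time)
qed

lemma sos_derivative_nonpos:
  assumes "sos \<psi>" "x \<in> ballR R" "t \<in> {0..T}" "d \<in> D"
  shows "eval_xtd (partial Time \<psi>) x t d
    + (\<Sum>i\<in>UNIV. eval_xtd (partial (State i) \<psi>) x t d * vector_field f x d $ i) \<le> 0"
proof -
  obtain s\<^sub>0 s\<^sub>1 s\<^sub>2 s' where s: "s\<^sub>0 \<in> sos_in xtd_vars" "s\<^sub>1 \<in> sos_in xtd_vars" "s\<^sub>2 \<in> sos_in xtd_vars"
    and s': "s' \<in> {1..nD} \<rightarrow> sos_in xtd_vars"
    and eq: "- (partial Time \<psi> + (\<Sum>i\<in>UNIV. partial (State i) \<psi> * f i)) =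
        s\<^sub>0 + s\<^sub>1 * gR R + s\<^sub>2 * (Var Time * (Const T - Var Time)) + (\<Sum>r\<in>{1..nD}. s' r * h r)"
    using assms(1) unfolding sos_constraints_def by blast
  have "- (eval_xtd (partial Time \<psi>) x t d
      + (\<Sum>i\<in>UNIV. eval_xtd (partial (State i) \<psi>) x t d * eval_xtd (f i) x t d))
    = eval_xtd s\<^sub>0 x t d + eval_xtd s\<^sub>1 x t d * (R - (norm x)\<^sup>2) + eval_xtd s\<^sub>2 x t d * (t * (T - t))
      + (\<Sum>r\<in>{1..nD}. eval_xtd (s' r) x t d * eval_xtd (h r) x t d)"
    using arg_cong[OF eq, of "\<lambda>p. eval_xtd p x t d"]
    by (simp add: eval_xtd_def ev_gR)
  moreover have "\<dots> \<ge> 0"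
  proof (intro add_nonneg_nonneg mult_nonneg_nonneg sum_nonneg eval_xtd_sos_nonneg[OF s(1)]
        eval_xtd_sos_nonneg[OF s(2)] eval_xtd_sos_nonneg[OF s(3)])
    fix r assume r: "r \<in> {1..nD}"
    show "eval_xtd (s' r) x t d \<ge> 0"
      using s' r by (intro eval_xtd_sos_nonneg) auto
    \<comment> \<open>\<open>h r\<close> involves only disturbance variables, so its value here is
      the one with dummy zeros in \<open>dist_set\<close>.\<close>
    show "eval_xtd (h r) x t d \<ge> 0"
      using assms(4) r eval_xtd_d_vars[OF h_vars[OF r], of x t d 0 0] by (simp add: dist_set_def)
  qed (use assms(2,3) in \<open>auto simp: mem_ballR\<close>)
  moreover have "vector_field f x d $ i = eval_xtd (f i) x t d" for i
    using eval_xtd_xd_vars[OF f_vars, of i x 0 d t] by (simp add: vector_field_def)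
  ultimately show ?thesis by simp
qed

text \<open>While the trajectory is in the ball, \<open>F\<close> agrees with the polynomial field
  there, so off a null set the derivative of \<psi> along it is the expression bounded by the first
  certificate.\<close>

lemma sos_nonincreasing:
  assumes "\<psi> \<in> polys_in xt_vars" "sos \<psi>" and d: "d \<in> inputs D T 0" and \<phi>: "solution F T x 0 d \<phi>"
    and r: "r \<in> {0..T}" and ball: "\<And>s. s \<in> {0..r} \<Longrightarrow> \<phi> s \<in> ballR R"
  shows "eval_xt \<psi> (\<phi> r) r \<le> eval_xt \<psi> x 0"
proof -
  obtain N where N: "negligible N" and deriv: "\<And>s. s \<in> {0..T} - N \<Longrightarrow>
      (\<phi> has_vector_derivative F (\<phi> s) (d s)) (at s within {0..T})"
    by (rule solution_deriv[OF \<phi>]) blast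
  have AC: "abs_continuous 0 r \<phi>"
    using \<phi> r unfolding solution_def by (auto elim: abs_continuous_subinterval)
  have "eval_xt \<psi> (\<phi> r) r \<le> eval_xt \<psi> (\<phi> 0) 0"
  proof (rule abs_continuous_nonincreasing[where z = "\<lambda>s. eval_xt \<psi> (\<phi> s) s", OF _ _ N])
    have "abs_continuous 0 r (\<lambda>s. assignment (\<phi> s) s (0 :: real ^ 'm) v)" for v
      by (cases v) (auto intro: abs_continuous_const abs_continuous_ident abs_continuous_vec_nth AC)
    then show "abs_continuous 0 r (\<lambda>s. eval_xt \<psi> (\<phi> s) s)"
      unfolding eval_xtd_def ev_eq
      by (intro abs_continuous_sum abs_continuous_mult abs_continuous_const abs_continuous_prod
          abs_continuous_power)
    fix s assume "s \<in> {0..r} - N"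
    then have s: "s \<in> {0..T} - N" "s \<in> {0..T}" "\<phi> s \<in> ballR R" and "d s \<in> D" and sub: "{0..r} \<subseteq> {0..T}"
      using r d ball by (auto simp: inputs_def)
    \<comment> \<open>The input has no derivative. Since \<psi> does not involve it, the disturbance
      is frozen at its value \<open>d s\<close> at the time considered, which is the one the
      certificate needs.\<close>
    have "((\<lambda>s'. eval_xtd \<psi> (\<phi> s') s' (d s)) has_real_derivative
        eval_xtd (partial Time \<psi>) (\<phi> s) s (d s)
        + (\<Sum>i\<in>UNIV. eval_xtd (partial (State i) \<psi>) (\<phi> s) s (d s) * F (\<phi> s) (d s) $ i)) (at s within {0..r})"
      by (intro has_real_derivative_eval_xtd has_vector_derivative_within_subset[OF deriv[OF s(1)] sub])
    then show "\<exists>z'\<le>0. ((\<lambda>s. eval_xt \<psi> (\<phi> s) s) has_real_derivative z') (at s within {0..r})"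
      using sos_derivative_nonpos[OF assms(2) s(3,2) \<open>d s \<in> D\<close>] F_eq[OF s(3) \<open>d s \<in> D\<close>]
      by (auto simp: eval_xtd_xt_vars[OF assms(1), of _ _ 0 "d s"])
  qed (use r in auto)
  then show ?thesis
    using \<phi> by (simp add: solution_def)
qed

lemma solution_continuous: "solution G T x 0 d \<phi> \<Longrightarrow> continuous_on {0..T} \<phi>"
  by (simp add: solution_def abs_continuous_imp_continuous_on)

text \<open>At the first time a trajectory leaves the interior of the ball, \<open>\<psi>\<close> is still nonpositive
  along it, so the state is in \<open>X\<close> and hence in the interior.\<close>

lemma sos_invariant:
  assumes "\<psi> \<in> polys_in xt_vars" "sos \<psi>" and d: "d \<in> inputs D T 0" and \<phi>: "solution F T x 0 d \<phi>"
    and x: "x \<in> X 0" "eval_xt \<psi> x 0 \<le> 0" and s: "s \<in> {0..T}"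
  shows "\<phi> s \<in> X s"
proof -
  have in_X: "\<phi> r \<in> X r" if "r \<in> {0..T}" "\<And>s. s \<in> {0..r} \<Longrightarrow> \<phi> s \<in> ballR R" for r
  proof -
    have "eval_xt \<psi> (\<phi> r) r \<le> 0"
      using sos_nonincreasing[OF assms(1-4) that] x(2) by simp
    then show ?thesis
      using eval_g_le[OF assms(2) that(2) that(1)] that(1) by (force simp: state_set_def)
  qed
  let ?E = "{s \<in> {0..T}. R \<le> (norm (\<phi> s))\<^sup>2}"
  have "?E = {}"
  proof (rule ccontr)
    assume "?E \<noteq> {}"
    have cont: "continuous_on {0..T} (\<lambda>s. (norm (\<phi> s))\<^sup>2)"
      by (intro continuous_intros solution_continuous[OF \<phi>])
    have "closed ?E"
      by (rule continuous_on_closed_Collect_le) (use cont in \<open>auto intro: continuous_intros\<close>)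
    then have "compact ?E"
      by (simp add: compact_eq_bounded_closed bounded_subset[of "{0..T}"] subset_iff)
    then obtain \<tau> where \<tau>: "\<tau> \<in> ?E" and least: "\<And>s. s \<in> ?E \<Longrightarrow> \<tau> \<le> s"
      using compact_attains_inf[OF _ \<open>?E \<noteq> {}\<close>] by auto
    have before: "(norm (\<phi> s))\<^sup>2 < R" if "0 \<le> s" "s < \<tau>" for s
      using least[of s] that \<tau> by force
    have "\<phi> 0 \<in> X 0"
      using \<phi> x by (simp add: solution_def)
    then have "(norm (\<phi> 0))\<^sup>2 < R"
      using X_strict[of 0 "\<phi> 0"] T_pos by simp
    \<comment> \<open>Membership in \<open>?E\<close> gives only a lower bound for the norm at
      \<tau>, while the closed ball needs an upper one. The value \<open>R\<close> is attained by
      time \<tau> and not earlier, so it is attained at \<tau>.\<close>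
    obtain s where "0 \<le> s" "s \<le> \<tau>" "(norm (\<phi> s))\<^sup>2 = R"
      using IVT'[of "\<lambda>s. (norm (\<phi> s))\<^sup>2" 0 R \<tau>] \<open>(norm (\<phi> 0))\<^sup>2 < R\<close> \<tau>
        continuous_on_subset[OF cont, of "{0..\<tau>}"] by auto
    then have "(norm (\<phi> \<tau>))\<^sup>2 = R"
      using before[of s] by (cases "s = \<tau>") auto
    then have "\<phi> s \<in> ballR R" if "s \<in> {0..\<tau>}" for s
      using before[of s] that by (cases "s = \<tau>") (auto simp: mem_ballR)
    then have "\<phi> \<tau> \<in> X \<tau>"
      using \<tau> by (intro in_X) auto
    then show False
      using X_strict[of \<tau> "\<phi> \<tau>"] \<tau> by auto
  qed
  then have "\<phi> s \<in> ballR R" if "s \<in> {0..T}" for s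
    using that by (force simp: mem_ballR)
  then show ?thesis
    using s by (intro in_X) auto
qed

section \<open>Trajectories, reachable set and value function\<close>

lemma solution_F_iff:
  assumes "d \<in> inputs D T 0" "\<And>s. s \<in> {0..T} \<Longrightarrow> \<phi> s \<in> ballR R"
  shows "solution F T x 0 d \<phi> \<longleftrightarrow> solution (vector_field f) T x 0 d \<phi>"
proof -
  have "F (\<phi> s) (d s) = vector_field f (\<phi> s) (d s)" if "s \<in> {0..T}" for s
    using assms that by (auto intro: F_eq simp: inputs_def)
  then show ?thesis
    unfolding solution_def AE_lebesgue_on_iff_negligible by (metis DiffD1)
qed

lemma exists_solution:
  assumes "d \<in> inputs D T 0"
  shows "\<exists>\<phi>. solution F T x 0 d \<phi>"
proof (rule caratheodory_existence[where F = F and D = D])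
  show "0 \<le> T"
    using T_pos by simp
  show "norm (F x d - F x' d) \<le> L * norm (x - x')" if "d \<in> D" for d x x'
    by (rule F_lip[OF that])
qed (use F_cont D_compact L_pos assms in auto)

text \<open>The set of costs is nonempty because a constant input has a solution, and bounded above
  because all trajectories from \<open>x\<close> stay in one ball on which the polynomials are
  bounded.\<close>

lemma value_le_iff:
  "value0 x \<le> c \<longleftrightarrow> (\<forall>d \<phi>. d \<in> inputs D T 0 \<and> solution F T x 0 d \<phi> \<longrightarrow> cost nX g nTR l T 0 \<phi> \<le> c)"
proof -
  let ?V = "{cost nX g nTR l T 0 \<phi> | d \<phi>. d \<in> inputs D T 0 \<and> solution F T x 0 d \<phi>}"
  obtain d\<^sub>0 where "d\<^sub>0 \<in> D"
    using D_nonempty by blast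
  then have "(\<lambda>_. d\<^sub>0) \<in> inputs D T 0"
    by (simp add: inputs_def)
  then have "?V \<noteq> {}"
    using exists_solution[of "\<lambda>_. d\<^sub>0" x] by blast
  obtain B where B: "\<And>d \<phi> s. \<lbrakk>d \<in> inputs D T 0; solution F T x 0 d \<phi>; s \<in> {0..T}\<rbrakk> \<Longrightarrow> norm (\<phi> s) \<le> B"
    by (rule solution_bounded[where T = T and t = 0 and x = x, OF F_cont D_compact less_imp_le[OF L_pos] F_lip]) blast+
  have "\<exists>c. \<forall>z\<in>cball 0 B \<times> {0..T}. eval_xt p (fst z) (snd z) \<le> c" for p :: "('n, 'm) rpoly"
  proof -
    have "bounded ((\<lambda>z. eval_xt p (fst z) (snd z)) ` (cball 0 B \<times> {0..T}))"
      by (intro compact_imp_bounded compact_continuous_image compact_Times continuous_on_eval_xtd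
          continuous_intros) auto
    from bounded_imp_bdd_above[OF this] show ?thesis
      unfolding bdd_above_def by blast
  qed
  then obtain c\<^sub>p where c\<^sub>p: "\<And>p :: ('n, 'm) rpoly. \<forall>z\<in>cball 0 B \<times> {0..T}. eval_xt p (fst z) (snd z) \<le> c\<^sub>p p"
    by metis
  have c: "eval_xt p y s \<le> c\<^sub>p p" if "norm y \<le> B" "s \<in> {0..T}" for p :: "('n, 'm) rpoly" and y s
    using bspec[OF c\<^sub>p, of "(y, s)" p] that by simp
  define M where "M = Max (c\<^sub>p ` (l ` {1..nTR} \<union> g ` {1..nX}))"
  have le_M: "c\<^sub>p (l j) \<le> M" if "j \<in> {1..nTR}" for j
    unfolding M_def using that by (intro Max_ge) auto
  have le_M': "c\<^sub>p (g i) \<le> M" if "i \<in> {1..nX}" for i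
    unfolding M_def using that by (intro Max_ge) auto
  have "cost nX g nTR l T 0 \<phi> \<le> M" if "d \<in> inputs D T 0" "solution F T x 0 d \<phi>" for d \<phi>
  proof -
    have bound: "norm (\<phi> s) \<le> B" if "s \<in> {0..T}" for s
      using B \<open>d \<in> inputs D T 0\<close> \<open>solution F T x 0 d \<phi>\<close> that by blast
    show ?thesis
      unfolding cost_le_iff[OF less_imp_le[OF T_pos] nX nTR solution_continuous[OF that(2)]]
    proof (intro conjI ballI)
      \<comment> \<open>\<open>eval_x\<close> is evaluation at time 0, so the bound is taken at the
        state \<open>\<phi> T\<close> but at time 0.\<close>
      show "eval_x (l j) (\<phi> T) \<le> M" if "j \<in> {1..nTR}" for j
        using le_M[OF that] c[OF bound, of T 0 "l j"] T_pos by auto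
      show "eval_xt (g i) (\<phi> s) s \<le> M" if "i \<in> {1..nX}" "s \<in> {0..T}" for i s
        using le_M'[OF that(1)] c[OF bound[OF that(2)] that(2), of "g i"] by auto
    qed
  qed
  then have "bdd_above ?V"
    by (auto simp: bdd_above_def)
  then have "value0 x \<le> c \<longleftrightarrow> (\<forall>v\<in>?V. v \<le> c)"
    unfolding value_fun_def by (rule cSup_le_iff[OF \<open>?V \<noteq> {}\<close>])
  then show ?thesis
    by blast
qed

lemma cost_nonpos_imp_constraints:
  assumes "solution F T x 0 d \<phi>" "cost nX g nTR l T 0 \<phi> \<le> 0"
  shows "\<And>s. s \<in> {0..T} \<Longrightarrow> \<phi> s \<in> X s" "\<phi> T \<in> target_set nTR l"
  using assms(2) T_pos
  unfolding cost_le_iff[OF less_imp_le[OF T_pos] nX nTR solution_continuous[OF assms(1)]]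
  by (auto simp: state_set_def target_set_def)

text \<open>Passes from existence of a solution for \<open>vector_field f\<close> to all solutions
  for \<open>F\<close>. A trajectory that obeys the constraints stays in the ball and solves both
  equations; one direction then uses uniqueness for \<open>F\<close>, the other existence.\<close>

lemma reach_iff:
  "x \<in> reach \<longleftrightarrow> (\<forall>d \<phi>. d \<in> inputs D T 0 \<and> solution F T x 0 d \<phi> \<longrightarrow>
    (\<forall>s\<in>{0..T}. \<phi> s \<in> X s) \<and> \<phi> T \<in> target_set nTR l)"
proof (intro iffI allI impI)
  fix d \<phi> assume x: "x \<in> reach" and *: "d \<in> inputs D T 0 \<and> solution F T x 0 d \<phi>"
  then obtain y where y: "solution (vector_field f) T x 0 d y" "\<And>s. s \<in> {0..T} \<Longrightarrow> y s \<in> X s"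
    "y T \<in> target_set nTR l"
    unfolding reach_set_def by blast
  then have "solution F T x 0 d y"
    using X_subset solution_F_iff[of d y x] * by blast
  then have "\<phi> s = y s" if "s \<in> {0..T}" for s
    using solution_unique[where F = F and D = D, OF F_lip] * that by blast
  then show "(\<forall>s\<in>{0..T}. \<phi> s \<in> X s) \<and> \<phi> T \<in> target_set nTR l"
    using y T_pos by auto
next
  assume *: "\<forall>d \<phi>. d \<in> inputs D T 0 \<and> solution F T x 0 d \<phi> \<longrightarrow>
    (\<forall>s\<in>{0..T}. \<phi> s \<in> X s) \<and> \<phi> T \<in> target_set nTR l"
  show "x \<in> reach"
    unfolding reach_set_def
  proof (intro CollectI ballI)
    fix d assume d: "d \<in> inputs D T 0"
    obtain \<phi> where \<phi>: "solution F T x 0 d \<phi>"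
      using exists_solution[OF d] by blast
    then have X: "\<forall>s\<in>{0..T}. \<phi> s \<in> X s" "\<phi> T \<in> target_set nTR l"
      using * d by blast+
    then have "solution (vector_field f) T x 0 d \<phi>"
      using X_subset solution_F_iff[OF d, of \<phi> x] \<phi> by blast
    with X show "\<exists>y. solution (vector_field f) T x 0 d y \<and> (\<forall>s\<in>{0..T}. y s \<in> X s) \<and> y T \<in> target_set nTR l"
      by blast
  qed
qed

lemma reach_eq: "reach = {x. value0 x \<le> 0}"
proof (intro set_eqI iffI CollectI)
  fix x assume x: "x \<in> reach"
  show "value0 x \<le> 0"
    unfolding value_le_iff
  proof (intro allI impI)
    fix d \<phi> assume *: "d \<in> inputs D T 0 \<and> solution F T x 0 d \<phi>"
    then have "\<forall>s\<in>{0..T}. \<phi> s \<in> X s" "\<phi> T \<in> target_set nTR l"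
      using x reach_iff by blast+
    then show "cost nX g nTR l T 0 \<phi> \<le> 0"
      using * by (subst cost_le_iff[OF less_imp_le[OF T_pos] nX nTR solution_continuous])
        (auto simp: state_set_def target_set_def)
  qed
next
  fix x assume "x \<in> {x. value0 x \<le> 0}"
  then show "x \<in> reach"
    unfolding reach_iff mem_Collect_eq value_le_iff using cost_nonpos_imp_constraints by blast
qed

lemma reach_subset_X: "reach \<subseteq> X 0"
proof
  fix x assume x: "x \<in> reach"
  obtain d where "d \<in> D"
    using D_nonempty by blast
  then have d: "(\<lambda>_. d) \<in> inputs D T 0"
    by (simp add: inputs_def)
  obtain \<phi> where \<phi>: "solution F T x 0 (\<lambda>_. d) \<phi>"
    using exists_solution[OF d] by blast
  then have "\<phi> 0 \<in> X 0"
    using x d T_pos unfolding reach_iff by (meson atLeastAtMost_iff less_imp_le order_refl)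
  then show "x \<in> X 0"
    using \<phi> by (simp add: solution_def)
qed

lemma sos_sublevel_subset_reach:
  assumes "\<psi> \<in> polys_in xt_vars" "sos \<psi>"
  shows "{x \<in> X 0. eval_xt \<psi> x 0 \<le> 0} \<subseteq> reach"
proof
  fix x assume x: "x \<in> {x \<in> X 0. eval_xt \<psi> x 0 \<le> 0}"
  show "x \<in> reach"
    unfolding reach_iff
  proof (intro allI impI conjI ballI)
    fix d \<phi> assume *: "d \<in> inputs D T 0 \<and> solution F T x 0 d \<phi>"
    show X: "\<phi> s \<in> X s" if "s \<in> {0..T}" for s
      using sos_invariant[OF assms] * x that by blast
    have ball: "\<phi> s \<in> ballR R" if "s \<in> {0..T}" for s
      using X[OF that] X_subset[OF that] by blast
    have "eval_x (l j) (\<phi> T) \<le> 0" if "j \<in> {1..nTR}" for j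
      using eval_l_le[OF assms(2) ball that, of T] sos_nonincreasing[OF assms, of d x \<phi> T] * ball x T_pos
      by force
    then show "\<phi> T \<in> target_set nTR l"
      by (simp add: target_set_def)
  qed
qed

text \<open>Starting in \<open>reach\<close> keeps every trajectory in the ball, where \<psi> does
  not increase along it and dominates each \<open>g i\<close> and, at time \<open>T\<close>, each
  \<open>l j\<close>. In particular \<psi> is nonnegative at points of value 0.\<close>

lemma value_le_sos:
  assumes "\<psi> \<in> polys_in xt_vars" "sos \<psi>" and x: "x \<in> reach"
  shows "value0 x \<le> eval_xt \<psi> x 0"
  unfolding value_le_iff
proof (intro allI impI)
  fix d \<phi> assume *: "d \<in> inputs D T 0 \<and> solution F T x 0 d \<phi>"
  then have X: "\<phi> s \<in> X s" if "s \<in> {0..T}" for s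
    using x that reach_iff by blast
  have ball: "\<phi> s \<in> ballR R" if "s \<in> {0..T}" for s
    using X[OF that] X_subset[OF that] by blast
  have le: "eval_xt \<psi> (\<phi> s) s \<le> eval_xt \<psi> x 0" if "s \<in> {0..T}" for s
    using sos_nonincreasing[OF assms(1,2)] * that ball by auto
  have "eval_x (l j) (\<phi> T) \<le> eval_xt \<psi> x 0" if "j \<in> {1..nTR}" for j
    using eval_l_le[OF assms(2) ball that, of T] le[of T] T_pos by force
  moreover have "eval_xt (g i) (\<phi> s) s \<le> eval_xt \<psi> x 0" if "i \<in> {1..nX}" "s \<in> {0..T}" for i s
    using eval_g_le[OF assms(2) ball[OF that(2)] that(2,1)] le[OF that(2)] by simp
  ultimately show "cost nX g nTR l T 0 \<phi> \<le> eval_xt \<psi> x 0"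
    using * by (subst cost_le_iff[OF less_imp_le[OF T_pos] nX nTR solution_continuous]) auto
qed

text \<open>On \<open>{value0 < 0}\<close> the sublevel sets of \<open>\<psi> k\<close> eventually contain the point. On
  \<open>{value0 = 0}\<close> the value \<open>\<psi> k\<close> is nonnegative, and it vanishes only on a null set because \<open>\<psi> k\<close> is
  eventually positive at the points of the sphere, where \<open>value0 > 0\<close>.\<close>

lemma sublevel_measure_tendsto:
  fixes \<psi> :: "nat \<Rightarrow> ('n, 'm) rpoly"
  assumes vars: "\<And>k. k \<ge> 1 \<Longrightarrow> \<psi> k \<in> polys_in xt_vars" and sos: "\<And>k. k \<ge> 1 \<Longrightarrow> sos (\<psi> k)"
    and lim: "uniform_limit (ballR R) (\<lambda>k x. eval_xt (\<psi> k) x 0) value0 sequentially"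
  defines "S \<equiv> \<lambda>k. {x \<in> X 0. eval_xt (\<psi> k) x 0 \<le> 0}"
  shows "reach - S k \<in> lmeasurable" "{x. value0 x = 0} \<in> lmeasurable"
    "(\<lambda>k. measure lebesgue (reach - S k)) \<longlonglongrightarrow> measure lebesgue {x. value0 x = 0}"
proof -
  have cont\<psi>: "continuous_on A (\<lambda>x. eval_xt (\<psi> k) x 0)" for A k
    by (intro continuous_on_eval_xtd continuous_intros)
  \<comment> \<open>Continuity comes from the uniform approximation, and it is what makes
    \<open>reach\<close> and the zero set of \<open>value0\<close> compact.\<close>
  have cont: "continuous_on (ballR R) value0"
    by (rule uniform_limit_theorem[OF always_eventually[OF allI[OF cont\<psi>]] lim]) simp
  have reach_ball: "reach \<subseteq> ballR R"
    using reach_subset_X X_subset[of 0] T_pos by auto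
  have ball: "compact (ballR R :: (real ^ 'n) set)"
    by (simp add: ballR_eq_cball)
  have "reach = {x \<in> ballR R. value0 x \<le> 0}"
    using reach_ball reach_eq by auto
  then have "closed reach"
    using continuous_on_closed_Collect_le[OF cont continuous_on_const, of 0] ball
    by (simp add: compact_imp_closed)
  then have "compact reach"
    using reach_ball ball by (metis compact_Int_closed inf.absorb_iff2)
  then have reach_meas: "reach \<in> lmeasurable"
    by (rule lmeasurable_compact)
  have zero: "{x. value0 x = 0} = reach \<inter> {x \<in> reach. value0 x = 0}"
    unfolding reach_eq by auto
  have "closed {x \<in> reach. value0 x = 0}"
    by (rule continuous_closed_preimage_constant[OF continuous_on_subset[OF cont reach_ball] \<open>closed reach\<close>])
  then have "compact {x. value0 x = 0}"
    unfolding zero by (rule compact_Int_closed[OF \<open>compact reach\<close>])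
  then show zero_meas: "{x. value0 x = 0} \<in> lmeasurable"
    by (rule lmeasurable_compact)
  have diff: "reach - S k = reach \<inter> {x. 0 < eval_xt (\<psi> k) x 0}" for k
    using reach_subset_X by (auto simp: S_def)
  have "open {x. 0 < eval_xt (\<psi> k) x 0}" for k
    by (intro open_Collect_less cont\<psi> continuous_intros)
  then have diff_sets: "reach - S k \<in> sets lebesgue" for k
    unfolding diff using fmeasurableD[OF reach_meas] by (intro sets.Int) auto
  then show diff_meas: "reach - S k \<in> lmeasurable" for k
    using fmeasurableI2[OF reach_meas] by blast
  have ptw: "(\<lambda>k. eval_xt (\<psi> k) x 0) \<longlonglongrightarrow> value0 x" if "x \<in> ballR R" for x
    by (rule tendsto_uniform_limitI[OF lim that])
  \<comment> \<open>Any point of the sphere works: it lies outside \<open>X 0\<close>, hence outside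
    \<open>reach\<close>, but still in the ball where the polynomials converge.\<close>
  obtain x\<^sub>1 :: "real ^ 'n" where "norm x\<^sub>1 = sqrt R"
    using vector_choose_size[of "sqrt R"] R_pos by auto
  then have x\<^sub>1: "(norm x\<^sub>1)\<^sup>2 = R"
    using R_pos by simp
  then have "x\<^sub>1 \<notin> reach"
    using X_strict[of 0 x\<^sub>1] T_pos reach_subset_X by auto
  then have "0 < value0 x\<^sub>1"
    using reach_eq by auto
  moreover have "x\<^sub>1 \<in> ballR R"
    using x\<^sub>1 by (simp add: mem_ballR)
  ultimately have "\<forall>\<^sub>F k in sequentially. 0 < eval_xt (\<psi> k) x\<^sub>1 0"
    using order_tendstoD(1)[OF ptw] by blast
  then obtain k\<^sub>0 where k\<^sub>0: "\<And>k. k \<ge> k\<^sub>0 \<Longrightarrow> 0 < eval_xt (\<psi> k) x\<^sub>1 0"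
    unfolding eventually_sequentially by blast
  \<comment> \<open>Finitely many early polynomials might vanish identically at time 0; only those
    known to be positive at \<open>x\<^sub>1\<close> enter the union.\<close>
  define Z where "Z = (\<Union>k\<in>{k\<^sub>0..}. {x. eval_xt (\<psi> k) x 0 = 0})"
  have "negligible Z"
    unfolding Z_def
  proof (rule negligible_countable_Union[of "(\<lambda>k. {x. eval_xt (\<psi> k) x 0 = 0}) ` {k\<^sub>0..}"])
    fix A assume "A \<in> (\<lambda>k. {x. eval_xt (\<psi> k) x 0 = 0}) ` {k\<^sub>0..}"
    then obtain k where "A = {x. eval_xt (\<psi> k) x 0 = 0}" "k\<^sub>0 \<le> k"
      by auto
    then show "negligible A"
      using negligible_eval_xtd_zeros[of "\<psi> k" x\<^sub>1 0 0] k\<^sub>0[of k] by simp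
  qed auto
  then have AE: "AE x in lebesgue. x \<notin> Z"
    by (simp add: negligible_iff_null_sets AE_not_in)
  have pt: "(\<lambda>k. indicator (reach - S k) x :: real) \<longlonglongrightarrow> indicator {x. value0 x = 0} x"
    if "x \<notin> Z" for x
  proof (rule tendsto_eventually)
    consider "x \<notin> reach" | "x \<in> reach" "value0 x < 0" | "x \<in> reach" "value0 x = 0"
      using reach_eq by force
    then show "\<forall>\<^sub>F k in sequentially. (indicator (reach - S k) x :: real) = indicator {x. value0 x = 0} x"
    proof cases
      case 1
      then show ?thesis
        using reach_eq by (auto simp: indicator_def)
    next
      case 2
      then have "\<forall>\<^sub>F k in sequentially. eval_xt (\<psi> k) x 0 < 0"
        using order_tendstoD(2)[OF ptw] reach_ball by blast
      then show ?thesis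
        by eventually_elim (use 2 in \<open>simp add: diff indicator_def\<close>)
    next
      case 3
      \<comment> \<open>Indices from 1 on satisfy the constraints, those from
        \<open>k\<^sub>0\<close> on have their zeros in \<open>Z\<close>.\<close>
      have "0 < eval_xt (\<psi> k) x 0" if "k \<ge> max 1 k\<^sub>0" for k
      proof -
        have "0 \<le> eval_xt (\<psi> k) x 0"
          using value_le_sos[OF vars sos 3(1), of k] that 3(2) by simp
        moreover have "eval_xt (\<psi> k) x 0 \<noteq> 0"
          using \<open>x \<notin> Z\<close> that by (auto simp: Z_def)
        ultimately show ?thesis by simp
      qed
      then show ?thesis
        using 3 unfolding eventually_sequentially diff
        by (intro exI[of _ "max 1 k\<^sub>0"]) (simp add: indicator_def)
    qed
  qed
  have "(\<lambda>k. \<integral>x. indicator (reach - S k) x \<partial>lebesgue) \<longlonglongrightarrow> (\<integral>x. indicator {x. value0 x = 0} x \<partial>lebesgue :: real)"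
  proof (rule integral_dominated_convergence[where w = "indicator reach"])
    show "integrable lebesgue (indicator reach :: _ \<Rightarrow> real)"
      using reach_meas by (intro integrable_real_indicator) (auto simp: fmeasurable_def)
    show "AE x in lebesgue. (\<lambda>k. indicator (reach - S k) x :: real) \<longlonglongrightarrow> indicator {x. value0 x = 0} x"
      using AE by eventually_elim (rule pt)
    show "AE x in lebesgue. norm (indicator (reach - S k) x :: real) \<le> indicator reach x" for k
      by (simp add: indicator_def)
  qed (use fmeasurableD[OF zero_meas] diff_sets in \<open>simp_all add: borel_measurable_indicator\<close>)
  then show "(\<lambda>k. measure lebesgue (reach - S k)) \<longlonglongrightarrow> measure lebesgue {x. value0 x = 0}"
    by simp
qed

end

text \<open>Membership in \<open>lmeasurable\<close> is part of the conclusion because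
  \<open>measure\<close> returns 0 on sets that are not measurable or have infinite measure, so the
  limit alone would say less.\<close>

theorem theorem6:
  fixes f :: "'n::finite \<Rightarrow> ('n, 'm::finite) rpoly"
    and h g l \<psi> :: "nat \<Rightarrow> ('n, 'm) rpoly"
    and F :: "real ^ 'n \<Rightarrow> real ^ 'm \<Rightarrow> real ^ 'n"
    and nD nX nTR N :: nat
    and T R :: real
    and D :: "(real ^ 'm) set"
    and X :: "real \<Rightarrow> (real ^ 'n) set"
    and TR R\<^sub>0 bdR\<^sub>0 :: "(real ^ 'n) set"
    and u :: "real ^ 'n \<Rightarrow> real \<Rightarrow> real"
    and X\<^sub>0\<^sub>k :: "nat \<Rightarrow> (real ^ 'n) set"
  assumes "T > 0"
    and "nD \<ge> 1" "nX \<ge> 1" "nTR \<ge> 1"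
    and "\<And>i. f i \<in> polys_in xd_vars"
    and "\<And>i. i \<in> {1..nD} \<Longrightarrow> h i \<in> polys_in d_vars"
    and "\<And>i. i \<in> {1..nX} \<Longrightarrow> g i \<in> polys_in xt_vars"
    and "\<And>j. j \<in> {1..nTR} \<Longrightarrow> l j \<in> polys_in x_vars"
    and D_def: "D = dist_set nD h"
    and "D \<noteq> {}" "compact D"
    and X_def: "X = state_set nX g"
    and "\<And>t. t \<in> {0..T} \<Longrightarrow> compact (X t)"
    and TR_def: "TR = target_set nTR l"
    and "R > 0"
    and "\<And>t. t \<in> {0..T} \<Longrightarrow> X t \<subseteq> ballR R"
    and "\<And>t. t \<in> {0..T} \<Longrightarrow> state_set_boundary nX g t \<inter> frontier (ballR R) = {}"
    and "continuous_on (UNIV \<times> D) (\<lambda>(x, d). F x d)"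
    and "\<exists>L. \<forall>d\<in>D. L-lipschitz_on UNIV (\<lambda>x. F x d)"
    and "\<And>x d. x \<in> ballR R \<Longrightarrow> d \<in> D \<Longrightarrow> F x d = vector_field f x d"
    and R0_def: "R\<^sub>0 = reach_set (vector_field f) D T X TR"
    and u_def: "u = value_fun F D nX g nTR l T"
    and "\<exists>i\<in>{1..nD}. \<exists>R\<^sub>D\<ge>0. h i = Const R\<^sub>D - (\<Sum>j\<in>UNIV. Var (Dist j) ^ 2)"
    and "N \<ge> 1"
    and "\<And>k. k \<ge> 1 \<Longrightarrow> \<psi> (k + N) \<in> polys_deg_le xt_vars (k + N)"
    and "\<And>k. k \<ge> 1 \<Longrightarrow> sos_constraints T R f nD h nX g nTR l (\<psi> (k + N))"
    and "uniform_limit (ballR R \<times> {0..T}) (\<lambda>k (x, t). eval_xt (\<psi> (k + N)) x t)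
           (\<lambda>(x, t). u x t) sequentially"
    and X0k_def: "\<And>k. X\<^sub>0\<^sub>k k = {x \<in> X 0. eval_xt (\<psi> (k + N)) x 0 \<le> 0}"
    and bdR0_def: "bdR\<^sub>0 = {x. u x 0 = 0}"
  shows "(\<forall>k\<ge>1. X\<^sub>0\<^sub>k k \<subseteq> R\<^sub>0) \<and>
    (\<forall>k\<ge>1. R\<^sub>0 - X\<^sub>0\<^sub>k k \<in> lmeasurable) \<and> bdR\<^sub>0 \<in> lmeasurable \<and>
    (\<lambda>k. measure lebesgue (R\<^sub>0 - X\<^sub>0\<^sub>k k)) \<longlonglongrightarrow> measure lebesgue bdR\<^sub>0"
proof -
  obtain L' where L': "\<forall>d\<in>D. L'-lipschitz_on UNIV (\<lambda>x. F x d)"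
    using assms(19) by blast
  \<comment> \<open>A Lipschitz constant may be 0; enlarging it by 1 gives the strict positivity
    asked for by the locale.\<close>
  define L where "L = L' + 1"
  have "L' \<ge> 0"
    using L' \<open>D \<noteq> {}\<close> lipschitz_on_nonneg by blast
  have lip: "norm (F x d - F x' d) \<le> L * norm (x - x')" if "d \<in> D" for d x x'
  proof -
    have "norm (F x d - F x' d) \<le> L' * norm (x - x')"
      using lipschitz_onD[of L' UNIV "\<lambda>x. F x d" x x'] L' that by (simp add: dist_norm)
    then show ?thesis
      by (simp add: L_def distrib_right) (use norm_ge_zero[of "x - x'"] in linarith)
  qed
  interpret constrained_system f h g l F nD nX nTR T R L
  proof
    show "L > 0"
      using \<open>L' \<ge> 0\<close> by (simp add: L_def)
  qed (use assms lip in \<open>(auto; fail)+\<close>)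
  have reach: "R\<^sub>0 = reach" and u: "u = value_fun F D nX g nTR l T"
    by (simp_all add: R0_def D_def X_def TR_def u_def)
  define \<psi>' where "\<psi>' = (\<lambda>k. \<psi> (k + N))"
  have vars: "\<psi>' k \<in> polys_in xt_vars" and sos: "sos (\<psi>' k)" if "k \<ge> 1" for k
    using assms(25,26)[OF that] polys_deg_le_subset by (auto simp: \<psi>'_def)
  have S: "X\<^sub>0\<^sub>k k = {x \<in> X 0. eval_xt (\<psi>' k) x 0 \<le> 0}" for k
    by (simp add: X0k_def \<psi>'_def)
  have "uniform_limit (ballR R) (\<lambda>k x. eval_xt (\<psi>' k) x 0) (\<lambda>x. u x 0) sequentially"
    unfolding uniform_limit_iff
  proof (intro allI impI)
    fix e :: real assume "e > 0"
    with assms(27) have "\<forall>\<^sub>F k in sequentially. \<forall>(x, t)\<in>ballR R \<times> {0..T}. dist (eval_xt (\<psi>' k) x t) (u x t) < e"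
      unfolding uniform_limit_iff \<psi>'_def by (auto simp: case_prod_unfold)
    then show "\<forall>\<^sub>F k in sequentially. \<forall>x\<in>ballR R. dist (eval_xt (\<psi>' k) x 0) (u x 0) < e"
      by eventually_elim (use \<open>T > 0\<close> in force)
  qed
  then have lim: "uniform_limit (ballR R) (\<lambda>k x. eval_xt (\<psi>' k) x 0) value0 sequentially"
    by (simp only: u D_def)
  note tendsto = sublevel_measure_tendsto[of \<psi>', OF vars sos lim]
  show ?thesis
    unfolding bdR0_def S reach u D_def X_def
    using sos_sublevel_subset_reach[OF vars sos] tendsto by blast
qed

end
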